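(* For every integer $k \geq 2$, there exists some $c_1=c_1(k) \in (0,1]$ such that, for every fixed $c$ with $c_1 \leq c \leq 1$, \[ r\big(B^{(k)}_{\lfloor cn\rfloor}, B^{(k)}_n\big) = \left(c^{1/k}+1\right)^k n + o(n) \quad \text{as } n \to \infty. \] Moreover, one may take $c_1(k) = \left((1+o(1))\frac{\log k}{k}\right)^k$, where $o(1)$ denotes a quantity tending to $0$ as $k \to \infty$.
   Context: The book graph $B^{(k)}_n$ consists of $n$ copies of $K_{k+1}$ glued along a common $K_k$. For graphs $H_1,H_2$, the Ramsey number $r(H_1,H_2)$ is the least $N$ such that every red/blue coloring of the edges of $K_N$ contains a red copy of $H_1$ or a blue copy of $H_2$. The logarithm is natural. *)

theory Defs
  imports "HOL-Library.Ramsey" "HOL-Library.Landau_Symbols"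
begin

text \<open>
  A graph is a pair of a vertex set and a set of edges, the edges being two-element
  sets of vertices.
\<close>

type_synonym 'a sgraph = "'a set \<times> 'a set set"

definition simple_graph :: "'a sgraph \<Rightarrow> bool" where
  "simple_graph G \<longleftrightarrow> finite (fst G) \<and> snd G \<subseteq> [fst G]\<^bsup>2\<^esup>"

definition complete_graph :: "'a set \<Rightarrow> 'a sgraph" where
  "complete_graph V = (V, [V]\<^bsup>2\<^esup>)"

text \<open>Copies are not required to be induced.\<close>

definition contains_copy :: "'a sgraph \<Rightarrow> 'b sgraph \<Rightarrow> bool" where
  "contains_copy G H \<longleftrightarrow>
     (\<exists>f. inj_on f (fst H) \<and> f ` fst H \<subseteq> fst G \<and> (\<forall>e\<in>snd H. f ` e \<in> snd G))"

text \<open>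
  A red/blue colouring of a complete graph is given by its set \<open>R\<close> of red edges, all
  other edges being blue.
\<close>

definition ramsey_arrows :: "nat \<Rightarrow> 'a sgraph \<Rightarrow> 'b sgraph \<Rightarrow> bool" where
  "ramsey_arrows N H1 H2 \<longleftrightarrow>
     (\<forall>R \<subseteq> snd (complete_graph {..<N}).
        contains_copy ({..<N}, R) H1 \<or>
        contains_copy ({..<N}, snd (complete_graph {..<N}) - R) H2)"

definition ramsey_number :: "'a sgraph \<Rightarrow> 'b sgraph \<Rightarrow> nat" where
  "ramsey_number H1 H2 = (LEAST N. ramsey_arrows N H1 H2)"

text \<open>
  The common \<open>K\<^sub>k\<close> has vertex set \<open>{..<k}\<close>, and each \<open>v \<in> {k..<k + n}\<close> is the remaining
  vertex of one of the \<open>n\<close> copies of \<open>K\<^sub>k\<^sub>+\<^sub>1\<close>. The common \<open>K\<^sub>k\<close> is listed separately because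
  of the case \<open>n = 0\<close>.
\<close>

definition book_graph :: "nat \<Rightarrow> nat \<Rightarrow> nat sgraph" where
  "book_graph k n =
     ({..<k + n},
      snd (complete_graph {..<k}) \<union>
      (\<Union>v\<in>{k..<k + n}. snd (complete_graph (insert v {..<k}))))"

lemma simple_graph_book_graph: "simple_graph (book_graph k n)"
  by (fastforce simp: simple_graph_def book_graph_def complete_graph_def nsets_def)

lemma contains_copy_clique:
  assumes H: "simple_graph H" and R: "R \<subseteq> V" "card R = card (fst H)" "finite R"
    and E: "[R]\<^bsup>2\<^esup> \<subseteq> E"
  shows "contains_copy (V, E) H"
proof -
  obtain f where f: "bij_betw f (fst H) R"
    using H R finite_same_card_bij unfolding simple_graph_def by metis
  have "f ` e \<in> E" if "e \<in> snd H" for e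
  proof -
    have "e \<in> [fst H]\<^bsup>2\<^esup>" using that H by (auto simp: simple_graph_def)
    then obtain x y where "e = {x, y}" "x \<in> fst H" "y \<in> fst H" "x \<noteq> y"
      by (rule nsets2_E)
    then have "f ` e \<in> [R]\<^bsup>2\<^esup>"
      using f by (auto simp: bij_betw_def inj_on_def)
    then show ?thesis using E by blast
  qed
  then show ?thesis
    using f R by (auto simp: contains_copy_def bij_betw_def intro!: exI[of _ f])
qed

text \<open>By Ramsey's theorem, the least element in \<^const>\<open>ramsey_number\<close> exists.\<close>

lemma ramsey_arrows_ramsey_number:
  assumes "simple_graph H1" and "simple_graph H2"
  shows "ramsey_arrows (ramsey_number H1 H2) H1 H2"
proof -
  obtain r where r: "\<forall>(V::nat set) (E::nat set set). finite V \<and> card V \<ge> r \<longrightarrow>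
    (\<exists>R \<subseteq> V. card R = card (fst H1) \<and> clique R E \<or> card R = card (fst H2) \<and> indep R E)"
    using ramsey2[of "card (fst H1)" "card (fst H2)"] by blast
  have "ramsey_arrows r H1 H2"
    unfolding ramsey_arrows_def
  proof (intro allI impI)
    fix R assume R: "R \<subseteq> snd (complete_graph {..<r})"
    obtain S where S: "S \<subseteq> {..<r}"
      "card S = card (fst H1) \<and> clique S R \<or> card S = card (fst H2) \<and> indep S R"
      using r[rule_format, of "{..<r}" R] by auto
    have fin: "finite S" using S finite_subset by blast
    from S(2) show "contains_copy ({..<r}, R) H1 \<or>
        contains_copy ({..<r}, snd (complete_graph {..<r}) - R) H2"
    proof
      assume *: "card S = card (fst H1) \<and> clique S R"
      then have "[S]\<^bsup>2\<^esup> \<subseteq> R" by (auto simp: clique_def nsets_2_eq)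
      then show ?thesis using contains_copy_clique[OF assms(1) S(1) _ fin] * by blast
    next
      assume *: "card S = card (fst H2) \<and> indep S R"
      then have "[S]\<^bsup>2\<^esup> \<subseteq> snd (complete_graph {..<r}) - R"
        using S(1) by (auto simp: indep_def nsets_2_eq complete_graph_def)
      then show ?thesis using contains_copy_clique[OF assms(2) S(1) _ fin] * by blast
    qed
  qed
  then show ?thesis unfolding ramsey_number_def by (rule LeastI)
qed

end

theory Submission
  imports "HOL-Probability.Probability" "HOL-Real_Asymp.Real_Asymp" Defs
begin

text \<open>
  Let \<open>t = c\<^sup>1\<^sup>/\<^sup>k\<close>, \<open>p = t / (1 + t)\<close> and \<open>q = 1 - p\<close>. The lower bound is a random
  colouring with red probability \<open>p\<close>. For the upper bound, note that a monochromatic clique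
  \<open>U\<close> of large constant size already plays the role of a regular set: if every vertex
  \<open>v\<close> has density \<open>d(v)\<close> to \<open>U\<close> in the colour of \<open>U\<close>, then a random
  \<open>k\<close>-subset of \<open>U\<close> has about \<open>\<Sum>v. d(v)\<^sup>k\<close> pages on average. So Szemeredi's
  regularity lemma is not needed.

  Take a maximal system of red cliques of constant size that are completely blue to each other.
  If it has fewer than \<open>k\<close> members, consider the vertices having at least a small positive blue
  density to every member. They contain no large red clique, since it would extend the system
  after passing to subcliques. The other vertices are almost completely red to some member, so
  if there are no large red books, they make up at most a fraction \<open>(k - 1) p\<^sup>k\<close> of all
  vertices. The same holds with the colours exchanged, and as \<open>(k - 1) (p\<^sup>k + q\<^sup>k) < 1\<close>,
  Ramsey's theorem forces a system of \<open>k\<close> cliques in one of the colours. Writing \<open>x\<^sub>i\<close> for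
  the red densities to \<open>k\<close> such red cliques, these cliques span red books and their transversals
  span blue books, and
  \<open>(1/k) \<Sum>x\<^sub>i\<^sup>k + (p/q)\<^sup>k\<^sup>-\<^sup>1 \<Prod>(1 - x\<^sub>i) \<ge> p\<^sup>k\<^sup>-\<^sup>1\<close>
  shows that one of these books is large.
\<close>

section \<open>Books on cliques of constant size\<close>

text \<open>Excluding equal vertices leaves the diagonal of \<open>\<kappa>\<close> free, so that
  any symmetric Boolean function can serve as a colouring, with \<open>True\<close> for red. It also
  keeps the pages of a book off its spine.\<close>

definition adj :: "('a \<Rightarrow> 'a \<Rightarrow> bool) \<Rightarrow> bool \<Rightarrow> 'a \<Rightarrow> 'a \<Rightarrow> bool" where
  "adj \<kappa> b u v \<longleftrightarrow> u \<noteq> v \<and> \<kappa> u v = b"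

definition mono_clique :: "('a \<Rightarrow> 'a \<Rightarrow> bool) \<Rightarrow> bool \<Rightarrow> 'a set \<Rightarrow> bool" where
  "mono_clique \<kappa> b K \<longleftrightarrow> (\<forall>u\<in>K. \<forall>v\<in>K. u \<noteq> v \<longrightarrow> \<kappa> u v = b)"

definition pages :: "('a \<Rightarrow> 'a \<Rightarrow> bool) \<Rightarrow> bool \<Rightarrow> 'a set \<Rightarrow> 'a set \<Rightarrow> 'a set" where
  "pages \<kappa> b V K = {v \<in> V. \<forall>u\<in>K. adj \<kappa> b u v}"

definition book_bounded :: "('a \<Rightarrow> 'a \<Rightarrow> bool) \<Rightarrow> bool \<Rightarrow> nat \<Rightarrow> 'a set \<Rightarrow> real \<Rightarrow> bool" where
  "book_bounded \<kappa> b k V \<beta> \<longleftrightarrow>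
     (\<forall>K\<subseteq>V. card K = k \<longrightarrow> mono_clique \<kappa> b K \<longrightarrow> real (card (pages \<kappa> b V K)) \<le> \<beta>)"

definition codeg :: "('a \<Rightarrow> 'a \<Rightarrow> bool) \<Rightarrow> bool \<Rightarrow> 'a set \<Rightarrow> 'a \<Rightarrow> nat" where
  "codeg \<kappa> b U v = card {u \<in> U. adj \<kappa> b u v}"

lemma codeg_le: "finite U \<Longrightarrow> codeg \<kappa> b U v \<le> card U"
  unfolding codeg_def by (intro card_mono) auto

lemma mono_clique_subset: "mono_clique \<kappa> b K \<Longrightarrow> K' \<subseteq> K \<Longrightarrow> mono_clique \<kappa> b K'"
  unfolding mono_clique_def by blast

lemma codeg_add_codeg:
  assumes "finite U" "v \<notin> U"
  shows "codeg \<kappa> b U v + codeg \<kappa> (\<not> b) U v = card U"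
proof -
  have "U = {u \<in> U. adj \<kappa> b u v} \<union> {u \<in> U. adj \<kappa> (\<not> b) u v}"
    using assms by (auto simp: adj_def)
  moreover have "card ({u \<in> U. adj \<kappa> b u v} \<union> {u \<in> U. adj \<kappa> (\<not> b) u v}) =
      codeg \<kappa> b U v + codeg \<kappa> (\<not> b) U v"
    unfolding codeg_def by (intro card_Un_disjoint) (use assms in \<open>auto simp: adj_def\<close>)
  ultimately show ?thesis by simp
qed

section \<open>Double counting of spines and pages\<close>

lemma sum_card_pages:
  assumes "finite F" "finite V"
  shows "(\<Sum>f\<in>F. card (pages \<kappa> b V (f ` I))) = (\<Sum>v\<in>V. card {f \<in> F. \<forall>i\<in>I. adj \<kappa> b (f i) v})"
proof -
  have "(\<Sum>f\<in>F. card (pages \<kappa> b V (f ` I))) =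
      (\<Sum>f\<in>F. \<Sum>v\<in>V. if \<forall>i\<in>I. adj \<kappa> b (f i) v then 1 else 0)"
    using assms by (intro sum.cong) (auto simp: pages_def simp flip: sum.inter_filter)
  also have "\<dots> = (\<Sum>v\<in>V. \<Sum>f\<in>F. if \<forall>i\<in>I. adj \<kappa> b (f i) v then 1 else 0)"
    by (rule sum.swap)
  finally show ?thesis using assms by (simp flip: sum.inter_filter)
qed

lemma power_diff_le_unit:
  fixes x y :: real
  assumes "0 \<le> y" "y \<le> x" "x \<le> 1"
  shows "x ^ k - y ^ k \<le> k * (x - y)"
proof (induction k)
  case (Suc k)
  have "x ^ Suc k - y ^ Suc k = x * (x ^ k - y ^ k) + (x - y) * y ^ k"
    by (simp add: algebra_simps)
  also have "\<dots> \<le> 1 * (x ^ k - y ^ k) + (x - y) * 1"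
    using assms by (intro add_mono mult_right_mono mult_left_mono)
      (auto intro!: power_mono power_le_one)
  also have "\<dots> \<le> Suc k * (x - y)"
    using Suc by (simp add: algebra_simps)
  finally show ?case .
qed simp

text \<open>The product counts injections of a k-set into an a-set. Each factor is at least the
  truncated difference \<open>a - k\<close>, and lowering the base from a/m to (a - k)/m costs at
  most k * (k/m).\<close>

lemma falling_product_ge:
  assumes "a \<le> m" "m > 0"
  shows "(real a / real m) ^ k - real k ^ 2 / real m \<le> real (\<Prod>i = 0..<k. a - i) / real m ^ k"
proof -
  define y where "y = real (a - k) / m"
  have xy: "real a / m - y \<le> k / m"
    unfolding y_def using assms by (simp flip: diff_divide_distrib) (simp add: divide_right_mono)
  have "(real a / m) ^ k - y ^ k \<le> k * (real a / m - y)"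
    using assms by (intro power_diff_le_unit) (auto simp: y_def divide_right_mono)
  also have "\<dots> \<le> k * (k / m)" using xy by (intro mult_left_mono) auto
  finally have "(real a / m) ^ k - real k ^ 2 / m \<le> y ^ k" by (simp add: power2_eq_square)
  also have "y ^ k = real ((a - k) ^ k) / real m ^ k" by (simp add: y_def power_divide)
  also have "(a - k) ^ k = (\<Prod>i = 0..<k. a - k)" by simp
  also have "real (\<Prod>i = 0..<k. a - k) / real m ^ k \<le> real (\<Prod>i = 0..<k. a - i) / real m ^ k"
    by (intro divide_right_mono, simp only: of_nat_le_iff, rule prod_mono) auto
  finally show ?thesis .
qed

text \<open>The spines are the injective maps of \<open>{..<k}\<close> into \<open>U\<close>, and
  each image is a clique of colour \<open>b\<close> with at most \<open>\<beta>\<close> pages. A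
  vertex is a page for a falling factorial of its \<open>codeg\<close> many spines; turning this
  into a power loses k^2/m per vertex, the price of sampling without replacement.\<close>

lemma sum_codeg_power_le:
  assumes V: "finite V" and U: "U \<subseteq> V" "card U = m" "m > 0" and mono: "mono_clique \<kappa> b U"
    and bound: "book_bounded \<kappa> b k V \<beta>" and "\<beta> \<ge> 0"
  shows "(\<Sum>v\<in>V. (real (codeg \<kappa> b U v) / m) ^ k) \<le> \<beta> + real k ^ 2 / m * card V"
proof -
  have finU: "finite U" using V U finite_subset by blast
  define F where "F = {f \<in> {..<k} \<rightarrow>\<^sub>E U. inj_on f {..<k}}"
  have finF: "finite F" unfolding F_def using finU by (auto intro!: finite_PiE)
  have cardF: "card F \<le> m ^ k"
  proof -
    have "card F \<le> card ({..<k} \<rightarrow>\<^sub>E U)"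
      unfolding F_def using finU by (intro card_mono) (auto intro!: finite_PiE)
    also have "\<dots> = m ^ k" using U by (simp add: card_PiE)
    finally show ?thesis .
  qed
  have "real (card {f \<in> F. \<forall>i\<in>{..<k}. adj \<kappa> b (f i) v}) = real (\<Prod>i = 0..<k. codeg \<kappa> b U v - i)" for v
  proof -
    have "{f \<in> F. \<forall>i\<in>{..<k}. adj \<kappa> b (f i) v} =
        {f \<in> {..<k} \<rightarrow>\<^sub>E {u \<in> U. adj \<kappa> b u v}. inj_on f {..<k}}"
      unfolding F_def by (auto simp: PiE_iff)
    also have "card \<dots> = (\<Prod>i = 0..<card {..<k}. card {u \<in> U. adj \<kappa> b u v} - i)"
      using finU card_inj_on_subset_funcset[of "{..<k}" "{u \<in> U. adj \<kappa> b u v}" "{..<k}"] by simp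
    finally show ?thesis by (simp add: codeg_def)
  qed
  then have eq: "(\<Sum>v\<in>V. real (\<Prod>i = 0..<k. codeg \<kappa> b U v - i)) =
      (\<Sum>f\<in>F. real (card (pages \<kappa> b V (f ` {..<k}))))"
    using sum_card_pages[OF finF V, of \<kappa> b "{..<k}"]
    by (metis (mono_tags, lifting) of_nat_sum sum.cong)
  have "(\<Sum>v\<in>V. (real (codeg \<kappa> b U v) / m) ^ k) - real k ^ 2 / m * card V =
      (\<Sum>v\<in>V. (real (codeg \<kappa> b U v) / m) ^ k - real k ^ 2 / m)"
    by (simp add: sum_subtractf)
  also have "\<dots> \<le> (\<Sum>v\<in>V. real (\<Prod>i = 0..<k. codeg \<kappa> b U v - i) / real m ^ k)"
    by (intro sum_mono falling_product_ge) (use codeg_le[OF finU] U in auto)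
  also have "\<dots> = (\<Sum>f\<in>F. real (card (pages \<kappa> b V (f ` {..<k})))) / real m ^ k"
    unfolding eq[symmetric] by (rule sum_divide_distrib[symmetric])
  also have "\<dots> \<le> (\<Sum>f\<in>F. \<beta>) / real m ^ k"
  proof (intro divide_right_mono sum_mono)
    fix f assume "f \<in> F"
    then have f: "f ` {..<k} \<subseteq> U" "inj_on f {..<k}" by (auto simp: F_def)
    then have "card (f ` {..<k}) = k" by (simp add: card_image)
    then show "real (card (pages \<kappa> b V (f ` {..<k}))) \<le> \<beta>"
      using bound f U mono_clique_subset[OF mono] unfolding book_bounded_def by blast
  qed simp
  also have "\<dots> \<le> \<beta>"
  proof -
    have "real (card F) * \<beta> \<le> real (m ^ k) * \<beta>"
      using cardF \<open>\<beta> \<ge> 0\<close> by (intro mult_right_mono) (auto simp only: of_nat_le_iff)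
    then show ?thesis using U by (simp add: field_simps)
  qed
  finally show ?thesis by simp
qed

text \<open>Here the spines are transversals with one vertex from each \<open>U i\<close>. The
  complete joins make each of the m^k choices a clique on \<open>k\<close> distinct vertices, and
  the choices with a given page form a product set, so there is no error term.\<close>

lemma sum_prod_codeg_le:
  assumes V: "finite V" and U: "\<And>i. i < k \<Longrightarrow> U i \<subseteq> V" "\<And>i. i < k \<Longrightarrow> card (U i) = m" "m > 0"
    and compl: "\<And>i j u v. i < k \<Longrightarrow> j < k \<Longrightarrow> i \<noteq> j \<Longrightarrow> u \<in> U i \<Longrightarrow> v \<in> U j \<Longrightarrow> adj \<kappa> b u v"
    and bound: "book_bounded \<kappa> b k V \<beta>"
  shows "(\<Sum>v\<in>V. \<Prod>i<k. real (codeg \<kappa> b (U i) v) / m) \<le> \<beta>"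
proof -
  have finU: "finite (U i)" if "i < k" for i using V U that finite_subset by blast
  define F where "F = (\<Pi>\<^sub>E i\<in>{..<k}. U i)"
  have finF: "finite F" unfolding F_def using finU by (auto intro!: finite_PiE)
  have cardF: "card F = m ^ k" unfolding F_def using U by (simp add: card_PiE)
  have "real (card {f \<in> F. \<forall>i\<in>{..<k}. adj \<kappa> b (f i) v}) = (\<Prod>i<k. real (codeg \<kappa> b (U i) v))" for v
  proof -
    have "{f \<in> F. \<forall>i\<in>{..<k}. adj \<kappa> b (f i) v} = (\<Pi>\<^sub>E i\<in>{..<k}. {u \<in> U i. adj \<kappa> b u v})"
      unfolding F_def by (intro set_eqI) (simp add: PiE_iff, blast)
    then show ?thesis by (simp add: card_PiE codeg_def)
  qed
  then have eq: "(\<Sum>v\<in>V. \<Prod>i<k. real (codeg \<kappa> b (U i) v)) =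
      (\<Sum>f\<in>F. real (card (pages \<kappa> b V (f ` {..<k}))))"
    using sum_card_pages[OF finF V, of \<kappa> b "{..<k}"]
    by (metis (mono_tags, lifting) of_nat_sum sum.cong)
  have "(\<Sum>v\<in>V. \<Prod>i<k. real (codeg \<kappa> b (U i) v) / m) =
      (\<Sum>f\<in>F. real (card (pages \<kappa> b V (f ` {..<k})))) / real m ^ k"
    unfolding eq[symmetric] by (simp add: sum_divide_distrib prod_dividef)
  also have "\<dots> \<le> (\<Sum>f\<in>F. \<beta>) / real m ^ k"
  proof (intro divide_right_mono sum_mono)
    fix f assume "f \<in> F"
    then have f: "\<And>i. i < k \<Longrightarrow> f i \<in> U i" by (auto simp: F_def)
    have a: "adj \<kappa> b (f i) (f j)" if "i < k" "j < k" "i \<noteq> j" for i j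
      using compl that f by blast
    have "inj_on f {..<k}"
      by (rule inj_onI) (metis a adj_def lessThan_iff)
    then have "card (f ` {..<k}) = k" by (simp add: card_image)
    moreover have "mono_clique \<kappa> b (f ` {..<k})"
      unfolding mono_clique_def using a by (auto simp: adj_def)
    moreover have "f ` {..<k} \<subseteq> V" using f U by blast
    ultimately show "real (card (pages \<kappa> b V (f ` {..<k}))) \<le> \<beta>"
      using bound unfolding book_bounded_def by blast
  qed simp
  also have "\<dots> = \<beta>" using cardF U by simp
  finally show ?thesis .
qed

section \<open>The density inequality\<close>

text \<open>Bernoulli's inequality at x/a - 1, multiplied by a^k.\<close>

lemma power_tangent_le:
  fixes a x :: real
  assumes "a > 0" "x \<ge> 0" "k > 0"
  shows "a ^ k + k * a ^ (k - 1) * (x - a) \<le> x ^ k"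
proof -
  have "1 + k * (x / a - 1) \<le> (1 + (x / a - 1)) ^ k"
    by (rule Bernoulli_inequality) (use assms in simp)
  then have "a ^ k * (1 + k * (x / a - 1)) \<le> a ^ k * (x / a) ^ k"
    using assms by (intro mult_left_mono) auto
  also have "\<dots> = x ^ k" using assms by (simp add: power_divide)
  also have "a ^ k * (1 + k * (x / a - 1)) = a ^ k + k * a ^ (k - 1) * (x - a)"
  proof -
    obtain n where n: "k = Suc n" using assms by (cases k) auto
    have x: "x - a = a * (x / a - 1)" using assms by (simp add: algebra_simps)
    show ?thesis unfolding n x by (simp add: algebra_simps)
  qed
  finally show ?thesis .
qed

text \<open>This is the density inequality with all densities equal to 1 - t. The weight of t^k is
  such that the tangents of the two summands at t = 1 - p have opposite slopes and add up to the
  constant p^(k-1).\<close>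

lemma weighted_power_sum_ge:
  fixes p t :: real
  assumes "0 < p" "p < 1" "0 \<le> t" "t \<le> 1" "k > 0"
  shows "p ^ (k - 1) \<le> (1 - t) ^ k + (p / (1 - p)) ^ (k - 1) * t ^ k"
proof -
  define c where "c = p ^ (k - 1)"
  have pk: "p ^ k = c * p" using assms by (cases k) (auto simp: c_def)
  have qk: "(1 - p) ^ k = (1 - p) ^ (k - 1) * (1 - p)" using assms by (cases k) auto
  have r: "(p / (1 - p)) ^ (k - 1) * (1 - p) ^ (k - 1) = c"
    using assms by (simp add: power_divide c_def)
  have "c = (c * p + k * c * ((1 - t) - p)) + (c * (1 - p) + k * c * (t - (1 - p)))"
    by (simp add: algebra_simps)
  also have "\<dots> = (c * p + k * c * ((1 - t) - p))
      + (p / (1 - p)) ^ (k - 1) * ((1 - p) ^ k + k * (1 - p) ^ (k - 1) * (t - (1 - p)))"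
    unfolding qk r[symmetric] by (simp add: algebra_simps)
  also have "\<dots> \<le> (1 - t) ^ k + (p / (1 - p)) ^ (k - 1) * t ^ k"
  proof (intro add_mono mult_left_mono)
    show "c * p + k * c * ((1 - t) - p) \<le> (1 - t) ^ k"
      using power_tangent_le[of p "1 - t" k] assms pk by (simp add: c_def)
    show "(1 - p) ^ k + k * (1 - p) ^ (k - 1) * (t - (1 - p)) \<le> t ^ k"
      using assms by (intro power_tangent_le) auto
  qed (use assms in auto)
  finally show ?thesis by (simp add: c_def)
qed

text \<open>
  In the variable \<open>z = ln y\<close>, the function \<open>(1 - y)\<^sup>k\<close> is convex exactly where
  \<open>y \<ge> 1/k\<close>. This allows Jensen's inequality for a fixed product of the \<open>y\<^sub>i\<close>.
\<close>

lemma convex_on_one_minus_exp_power: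
  assumes "k \<ge> 2"
  shows "convex_on {- ln (real k)..0} (\<lambda>z. (1 - exp z) ^ k)"
proof -
  obtain l where l: "k = Suc (Suc l)" using assms by (metis le_add_diff_inverse add_2_eq_Suc)
  show ?thesis
  proof (rule f''_ge0_imp_convex)
    show "convex {- ln (real k)..0}" by simp
    have d: "((\<lambda>z. (1 - exp z) ^ Suc n) has_real_derivative - (real (Suc n) * (1 - exp z) ^ n * exp z)) (at z)"
      for n and z :: real
      by (rule derivative_eq_intros refl)+ simp
    show "((\<lambda>z. (1 - exp z) ^ k) has_real_derivative - real k * exp z * (1 - exp z) ^ Suc l) (at z)" for z
      unfolding l by (rule DERIV_cong[OF d]) (simp add: algebra_simps)
    show "((\<lambda>z. - real k * exp z * (1 - exp z) ^ Suc l) has_real_derivative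
        real k * exp z * (1 - exp z) ^ l * (real k * exp z - 1)) (at z)" for z
      unfolding l by (rule DERIV_cong[OF DERIV_mult[OF DERIV_cmult[OF DERIV_exp] d]])
        (simp add: algebra_simps)
    show "real k * exp z * (1 - exp z) ^ l * (real k * exp z - 1) \<ge> 0" if "z \<in> {- ln (real k)..0}" for z
    proof -
      have "exp (- ln (real k)) \<le> exp z" using that by simp
      then have "1 / real k \<le> exp z" using assms by (simp add: exp_minus inverse_eq_divide)
      then have "0 \<le> real k * exp z - 1" using assms by (simp add: field_simps)
      then show ?thesis using that by (intro mult_nonneg_nonneg zero_le_power) auto
    qed
  qed
qed

text \<open>Jensen's inequality for the convex function above, at the points \<open>ln (y i)\<close>
  with equal weights. Replacing every \<open>y i\<close> by the geometric mean \<open>t\<close>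
  keeps the product and does not increase the power sum.\<close>

lemma sum_power_ge_geometric_mean:
  fixes y :: "nat \<Rightarrow> real"
  assumes "k \<ge> 2" and y: "\<And>i. i < k \<Longrightarrow> 1 / k \<le> y i" "\<And>i. i < k \<Longrightarrow> y i \<le> 1"
  obtains t where "0 \<le> t" "t \<le> 1" "t ^ k = (\<Prod>i<k. y i)" "(1 - t) ^ k \<le> (\<Sum>i<k. (1 - y i) ^ k) / k"
proof
  have pos: "y i > 0" if "i < k" for i
    using y(1)[OF that] assms(1) by (smt (verit) of_nat_0_less_iff zero_less_divide_iff not_numeral_le_zero gr0I)
  define t where "t = exp ((\<Sum>i<k. ln (y i)) / k)"
  show "0 \<le> t" by (simp add: t_def)
  have "(\<Sum>i<k. ln (y i)) \<le> 0" using pos y by (intro sum_nonpos) (auto simp: ln_le_zero_iff)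
  then show "t \<le> 1" by (simp add: t_def divide_nonpos_nonneg)
  have "t ^ k = exp (\<Sum>i<k. ln (y i))"
    using assms(1) by (simp add: t_def flip: exp_of_nat_mult)
  also have "\<dots> = (\<Prod>i<k. y i)" using pos by (simp add: exp_sum)
  finally show "t ^ k = (\<Prod>i<k. y i)" .
  have "(1 - exp (\<Sum>i<k. (1 / k) *\<^sub>R ln (y i))) ^ k \<le> (\<Sum>i<k. (1 / k) * (1 - exp (ln (y i))) ^ k)"
  proof (rule convex_on_sum[OF _ _ convex_on_one_minus_exp_power[OF assms(1)]])
    show "(\<Sum>i<k. 1 / real k) = 1" using assms(1) by simp
    show "ln (y i) \<in> {- ln (real k)..0}" if "i \<in> {..<k}" for i
    proof -
      have "ln (1 / real k) \<le> ln (y i)" using that y assms(1) pos by (intro ln_mono) auto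
      then show ?thesis using that y pos assms(1) by (auto simp: ln_div ln_le_zero_iff)
    qed
  qed (use assms in \<open>auto simp: lessThan_empty_iff\<close>)
  also have "(\<Sum>i<k. (1 / k) * (1 - exp (ln (y i))) ^ k) = (\<Sum>i<k. (1 - y i) ^ k) / k"
    using pos by (simp add: sum_divide_distrib)
  also have "(\<Sum>i<k. (1 / k) *\<^sub>R ln (y i)) = (\<Sum>i<k. ln (y i)) / k"
    by (simp add: sum_divide_distrib)
  finally show "(1 - t) ^ k \<le> (\<Sum>i<k. (1 - y i) ^ k) / k" by (simp add: t_def)
qed

text \<open>For a single vertex, \<open>x i\<close> is its density to the i-th of \<open>k\<close>
  cliques. For 0 < p < 1, equality holds when all \<open>x i\<close> are \<open>p\<close>, as
  expected in a random colouring; the weight of the product balances the slopes there.\<close>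

definition book_ineq :: "nat \<Rightarrow> real \<Rightarrow> bool" where
  "book_ineq k p \<longleftrightarrow> (\<forall>x::nat \<Rightarrow> real. (\<forall>i<k. 0 \<le> x i \<and> x i \<le> 1) \<longrightarrow>
     p ^ (k - 1) \<le> (\<Sum>i<k. x i ^ k) / k + (p / (1 - p)) ^ (k - 1) * (\<Prod>i<k. 1 - x i))"

text \<open>If every 1 - x i is at least 1/k, Jensen's inequality reduces the claim to equal
  densities. Otherwise some \<open>x j\<close> exceeds 1 - 1/k, and by \<open>small\<close> its
  power alone suffices. At p = 1/2 the condition \<open>small\<close> holds for k = 5 but fails for
  k = 2, 3, 4, so these cases are proved directly below.\<close>

lemma book_ineqI:
  assumes k: "k \<ge> 2" and p: "0 < p" "p < 1" and small: "k * p ^ (k - 1) \<le> (1 - 1 / k) ^ k"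
  shows "book_ineq k p"
  unfolding book_ineq_def
proof (intro allI impI)
  fix x :: "nat \<Rightarrow> real" assume x: "\<forall>i<k. 0 \<le> x i \<and> x i \<le> 1"
  show "p ^ (k - 1) \<le> (\<Sum>i<k. x i ^ k) / k + (p / (1 - p)) ^ (k - 1) * (\<Prod>i<k. 1 - x i)"
  proof (cases "\<forall>i<k. 1 / k \<le> 1 - x i")
    case True
    then obtain t where t: "0 \<le> t" "t \<le> 1" "t ^ k = (\<Prod>i<k. 1 - x i)"
      "(1 - t) ^ k \<le> (\<Sum>i<k. (1 - (1 - x i)) ^ k) / k"
      using sum_power_ge_geometric_mean[of k "\<lambda>i. 1 - x i"] k x by auto
    have "p ^ (k - 1) \<le> (1 - t) ^ k + (p / (1 - p)) ^ (k - 1) * t ^ k"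
      by (rule weighted_power_sum_ge) (use p t k in auto)
    also have "\<dots> \<le> (\<Sum>i<k. x i ^ k) / k + (p / (1 - p)) ^ (k - 1) * (\<Prod>i<k. 1 - x i)"
      using t by simp
    finally show ?thesis .
  next
    case False
    then obtain j where j: "j < k" "1 - x j < 1 / k" by (meson not_le)
    have "k * p ^ (k - 1) \<le> (1 - 1 / k) ^ k" by (rule small)
    also have "\<dots> \<le> x j ^ k" using j k by (intro power_mono) (auto simp: field_simps)
    also have "\<dots> \<le> (\<Sum>i<k. x i ^ k)"
      by (rule member_le_sum) (use j x in auto)
    finally have "p ^ (k - 1) \<le> (\<Sum>i<k. x i ^ k) / k"
      using k by (simp add: field_simps)
    moreover have "0 \<le> (p / (1 - p)) ^ (k - 1) * (\<Prod>i<k. 1 - x i)"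
      using p x by (auto intro!: mult_nonneg_nonneg prod_nonneg)
    ultimately show ?thesis by linarith
  qed
qed

section \<open>The inequality at p = 1/2 for k = 2, 3, 4\<close>

lemma book_ineq_half_2: "book_ineq 2 (1 / 2)"
  unfolding book_ineq_def
proof (intro allI impI)
  fix x :: "nat \<Rightarrow> real"
  have "1 / 2 \<le> (x 0 + x 1 - 1)\<^sup>2 / 2 + 1 / 2" by simp
  also have "\<dots> = (x 0 ^ 2 + x 1 ^ 2) / 2 + (1 - x 0) * (1 - x 1)"
    by (simp add: power2_eq_square field_simps)
  finally show "(1 / 2) ^ (2 - 1) \<le> (\<Sum>i<2. x i ^ 2) / real 2
      + (1 / 2 / (1 - 1 / 2)) ^ (2 - 1) * (\<Prod>i<2. 1 - x i)"
    by (simp add: eval_nat_numeral)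
qed

text \<open>In terms of the deviations from 1/2, the cubic part of the right-hand side is (a^3 + b^3
  + c^3)/3 - abc, which has the factor a + b + c. Hence everything can be expressed through
  \<open>s\<close> and \<open>q\<close>.\<close>

lemma book_ineq_half_3: "book_ineq 3 (1 / 2)"
  unfolding book_ineq_def
proof (intro allI impI)
  fix x :: "nat \<Rightarrow> real" assume x: "\<forall>i<3. 0 \<le> x i \<and> x i \<le> 1"
  define a b c where "a = x 0 - 1 / 2" and "b = x 1 - 1 / 2" and "c = x 2 - 1 / 2"
  define s q where "s = - (a + b + c)" and "q = a\<^sup>2 + b\<^sup>2 + c\<^sup>2"
  have ab: "\<bar>a\<bar> \<le> 1 / 2" "\<bar>b\<bar> \<le> 1 / 2" "\<bar>c\<bar> \<le> 1 / 2"
    using x[rule_format, of 0] x[rule_format, of 1] x[rule_format, of 2]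
    by (auto simp: a_def b_def c_def abs_if)
  then have s: "- 3 / 2 \<le> s" "s \<le> 3 / 2" by (auto simp: s_def abs_if split: if_splits)
  have "a\<^sup>2 \<le> (1 / 2)\<^sup>2" "b\<^sup>2 \<le> (1 / 2)\<^sup>2" "c\<^sup>2 \<le> (1 / 2)\<^sup>2"
    using ab[THEN power_mono, of 2] by simp_all
  then have q: "0 \<le> q" "q \<le> 3 / 4" by (auto simp: q_def power2_eq_square)
  have "0 \<le> q * (1 / 4 - s / 2) + s\<^sup>2 * (1 / 4 + s / 6)"
  proof (cases "s \<le> 1 / 2")
    case True
    then have "0 \<le> 1 / 4 - s / 2" "0 \<le> 1 / 4 + s / 6" using s by auto
    then show ?thesis using q by (metis add_nonneg_nonneg mult_nonneg_nonneg zero_le_power2)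
  next
    case False
    \<comment> \<open>For s > 1/2 the coefficient of \<open>q\<close> is negative, so q = 3/4 is the
      worst case, and there a square can be completed.\<close>
    have "0 \<le> (s / 2 - 3 / 8)\<^sup>2 + 3 / 64 + s\<^sup>2 * (s / 6)" using False by simp
    also have "\<dots> = (3 / 4) * (1 / 4 - s / 2) + s\<^sup>2 * (1 / 4 + s / 6)"
      by (simp add: power2_eq_square algebra_simps)
    also have "\<dots> \<le> q * (1 / 4 - s / 2) + s\<^sup>2 * (1 / 4 + s / 6)"
      using q False by (intro add_right_mono mult_right_mono_neg) auto
    finally show ?thesis .
  qed
  moreover have "((a + 1 / 2) ^ 3 + (b + 1 / 2) ^ 3 + (c + 1 / 2) ^ 3) / 3
      + (1 / 2 - a) * (1 / 2 - b) * (1 / 2 - c) = 1 / 4 + (q * (1 / 4 - s / 2) + s\<^sup>2 * (1 / 4 + s / 6))"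
    by (simp add: s_def q_def power2_eq_square power3_eq_cube field_simps)
  ultimately have "1 / 4 \<le> (x 0 ^ 3 + x 1 ^ 3 + x 2 ^ 3) / 3 + (1 - x 0) * (1 - x 1) * (1 - x 2)"
    by (simp add: a_def b_def c_def)
  then show "(1 / 2) ^ (3 - 1) \<le> (\<Sum>i<3. x i ^ 3) / real 3
      + (1 / 2 / (1 - 1 / 2)) ^ (3 - 1) * (\<Prod>i<3. 1 - x i)"
    by (simp add: eval_nat_numeral)
qed

text \<open>The variables are grouped into two pairs. In each pair, \<open>pair\<close> (the case k
  = 2) compares the mean square with the product of the complements, and \<open>sq\<close> bounds
  the fourth powers by the squared mean square. What remains is \<open>key\<close>, for two products
  and two mean squares.\<close>

lemma book_ineq_half_4: "book_ineq 4 (1 / 2)"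
  unfolding book_ineq_def
proof (intro allI impI)
  fix x :: "nat \<Rightarrow> real" assume x: "\<forall>i<4. 0 \<le> x i \<and> x i \<le> 1"
  have pair: "1 / 2 - (1 - a) * (1 - b) \<le> (a\<^sup>2 + b\<^sup>2) / 2" for a b :: real
    using sum_power2_ge_zero[of "a + b - 1" 0] by (simp add: power2_eq_square algebra_simps)
  have sq: "((a\<^sup>2 + b\<^sup>2) / 2)\<^sup>2 \<le> (a ^ 4 + b ^ 4) / 2" for a b :: real
    using zero_le_power2[of "a\<^sup>2 - b\<^sup>2"] by (simp add: power2_eq_square eval_nat_numeral algebra_simps)
  have key: "1 / 8 \<le> u * w + (A\<^sup>2 + B\<^sup>2) / 2"
    if "0 \<le> u" "0 \<le> w" "1 / 2 - u \<le> A" "1 / 2 - w \<le> B" "0 \<le> A" "0 \<le> B" for u w A B :: real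
  proof -
    have A: "(1 / 2 - u)\<^sup>2 \<le> A\<^sup>2" if "u \<le> 1 / 2"
      using that \<open>1 / 2 - u \<le> A\<close> by (intro power_mono) auto
    have B: "(1 / 2 - w)\<^sup>2 \<le> B\<^sup>2" if "w \<le> 1 / 2"
      using that \<open>1 / 2 - w \<le> B\<close> by (intro power_mono) auto
    \<comment> \<open>The bound 1/2 - u on \<open>A\<close> can be squared only if it is
      nonnegative. For u > 1/2, the term with \<open>A\<close> is dropped and \<open>u\<close> is
      lowered to 1/2 instead; likewise for \<open>w\<close> and \<open>B\<close>.\<close>
    consider "u \<le> 1 / 2" "w \<le> 1 / 2" | "u > 1 / 2" "w \<le> 1 / 2" | "u \<le> 1 / 2" "w > 1 / 2"
      | "u > 1 / 2" "w > 1 / 2" by linarith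
    then show ?thesis
    proof cases
      case 1
      have "1 / 8 \<le> (u + w - 1 / 2)\<^sup>2 / 2 + 1 / 8" by simp
      also have "\<dots> = u * w + ((1 / 2 - u)\<^sup>2 + (1 / 2 - w)\<^sup>2) / 2"
        by (simp add: power2_eq_square field_simps)
      also have "\<dots> \<le> u * w + (A\<^sup>2 + B\<^sup>2) / 2"
        using A[OF 1(1)] B[OF 1(2)] by (intro add_left_mono divide_right_mono add_mono) auto
      finally show ?thesis .
    next
      case 2
      have "1 / 8 \<le> (1 / 2) * w + (1 / 2 - w)\<^sup>2 / 2" by (simp add: power2_eq_square field_simps)
      also have "\<dots> \<le> u * w + (A\<^sup>2 + B\<^sup>2) / 2"
        using 2 that B[OF 2(2)]
        by (intro add_mono mult_right_mono divide_right_mono add_increasing) auto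
      finally show ?thesis .
    next
      case 3
      have "1 / 8 \<le> u * (1 / 2) + (1 / 2 - u)\<^sup>2 / 2" by (simp add: power2_eq_square field_simps)
      also have "\<dots> \<le> u * w + (A\<^sup>2 + B\<^sup>2) / 2"
        using 3 that A[OF 3(1)]
        by (intro add_mono mult_left_mono divide_right_mono add_increasing2) auto
      finally show ?thesis .
    next
      case 4
      have "(1 / 2) * (1 / 2) \<le> u * w" using 4 by (intro mult_mono) auto
      then show ?thesis by (simp add: add_nonneg_nonneg add_increasing2)
    qed
  qed
  have "1 / 8 \<le> ((1 - x 0) * (1 - x 1)) * ((1 - x 2) * (1 - x 3))
      + ((((x 0)\<^sup>2 + (x 1)\<^sup>2) / 2)\<^sup>2 + (((x 2)\<^sup>2 + (x 3)\<^sup>2) / 2)\<^sup>2) / 2"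
    using x by (intro key pair) auto
  also have "\<dots> \<le> ((1 - x 0) * (1 - x 1)) * ((1 - x 2) * (1 - x 3))
      + ((x 0 ^ 4 + x 1 ^ 4) / 2 + (x 2 ^ 4 + x 3 ^ 4) / 2) / 2"
    by (intro add_mono divide_right_mono sq) auto
  also have "\<dots> = (x 0 ^ 4 + x 1 ^ 4 + x 2 ^ 4 + x 3 ^ 4) / 4
      + (1 - x 0) * (1 - x 1) * (1 - x 2) * (1 - x 3)"
    by (simp add: add_divide_distrib mult.assoc)
  finally show "(1 / 2) ^ (4 - 1) \<le> (\<Sum>i<4. x i ^ 4) / real 4
      + (1 / 2 / (1 - 1 / 2)) ^ (4 - 1) * (\<Prod>i<4. 1 - x i)"
    by (simp add: eval_nat_numeral)
qed

text \<open>With l = k - 1, the power (1 - 1/k)^l is the reciprocal of (1 + 1/l)^l, which is at most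
  e and so at most 3; the remaining factor is at least 3/4. This replaces the right-hand side of
  \<open>small\<close> by a constant.\<close>

lemma one_minus_inverse_power_ge:
  assumes "k \<ge> 4"
  shows "1 / 4 \<le> (1 - 1 / real k) ^ k"
proof -
  obtain l where l: "k = Suc l" using assms by (cases k) auto
  have "(1 + 1 / real l) ^ l \<le> exp (1 / real l) ^ l"
    by (intro power_mono) (auto intro: exp_ge_add_one_self add_nonneg_nonneg)
  also have "\<dots> = exp 1" using assms l by (simp flip: exp_of_nat_mult)
  also have "\<dots> \<le> 3" by (rule exp_le)
  finally have 3: "(1 + 1 / real l) ^ l \<le> 3" .
  have eq: "1 - 1 / real k = 1 / (1 + 1 / real l)"
    using assms l by (simp add: field_simps)
  have "1 / 3 \<le> (1 - 1 / real k) ^ l"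
    unfolding eq power_one_over by (rule divide_left_mono[OF 3]) (auto intro!: zero_less_power add_pos_nonneg mult_pos_pos)
  moreover have "3 / 4 \<le> 1 - 1 / real k" using assms by (simp add: field_simps)
  ultimately have "(3 / 4) * (1 / 3) \<le> (1 - 1 / real k) * (1 - 1 / real k) ^ l"
    by (intro mult_mono) auto
  then show ?thesis by (simp add: l)
qed

section \<open>Systems of cliques\<close>

text \<open>The members are pairwise disjoint, because \<open>adj\<close> fails for equal vertices.
  A system with r = k yields spines of both colours: k-subsets of a member in colour
  \<open>b\<close>, transversals in the other.\<close>

definition clique_system ::
  "('a \<Rightarrow> 'a \<Rightarrow> bool) \<Rightarrow> bool \<Rightarrow> nat \<Rightarrow> nat \<Rightarrow> 'a set \<Rightarrow> (nat \<Rightarrow> 'a set) \<Rightarrow> bool" where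
  "clique_system \<kappa> b r m V U \<longleftrightarrow>
     (\<forall>i<r. U i \<subseteq> V \<and> card (U i) = m \<and> mono_clique \<kappa> b (U i)) \<and>
     (\<forall>i<r. \<forall>j<r. i \<noteq> j \<longrightarrow> (\<forall>u\<in>U i. \<forall>v\<in>U j. adj \<kappa> (\<not> b) u v))"

lemma adj_sym: "(\<And>u v. \<kappa> u v = \<kappa> v u) \<Longrightarrow> adj \<kappa> b u v = adj \<kappa> b v u"
  by (auto simp: adj_def)

text \<open>Classify the vertices of \<open>C\<close> by their neighbourhood in the union
  \<open>W\<close> of the members. There are at most 2^(r m') classes, so some \<open>m\<close>
  vertices \<open>D\<close> of \<open>C\<close> have the same neighbourhood \<open>y\<close>. It
  meets every \<open>U i\<close> in at least \<open>m\<close> vertices; \<open>m\<close> of these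
  from each member, together with \<open>D\<close>, form the new system.\<close>

lemma clique_system_extend:
  assumes sym: "\<And>u v. \<kappa> u v = \<kappa> v u" and V: "finite V"
    and U: "clique_system \<kappa> b r m' V U" and "m > 0"
    and C: "C \<subseteq> V" "mono_clique \<kappa> b C" "m * 2 ^ (r * m') \<le> card C"
    and large: "\<And>v i. v \<in> C \<Longrightarrow> i < r \<Longrightarrow> m \<le> codeg \<kappa> (\<not> b) (U i) v"
  obtains U' where "clique_system \<kappa> b (Suc r) m V U'"
proof -
  define W where "W = (\<Union>i<r. U i)"
  define g where "g v = {u \<in> W. adj \<kappa> (\<not> b) u v}" for v
  have UV: "U i \<subseteq> V" "card (U i) = m'" "mono_clique \<kappa> b (U i)" if "i < r" for i
    using U that unfolding clique_system_def by auto
  have finW: "finite W" unfolding W_def using UV V finite_subset by blast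
  have "card W \<le> (\<Sum>i<r. card (U i))" unfolding W_def by (rule card_UN_le) simp
  also have "\<dots> = r * m'" using UV by simp
  finally have cardW: "card W \<le> r * m'" .
  have finC: "finite C" using C V finite_subset by blast
  have "\<exists>y\<in>Pow W. card C \<le> card (g -` {y} \<inter> C) * card (Pow W)"
    by (rule pigeonhole_card) (use finW finC in \<open>auto simp: g_def\<close>)
  then obtain y where y: "y \<subseteq> W" "card C \<le> card (g -` {y} \<inter> C) * 2 ^ card W"
    using finW by (auto simp: card_Pow)
  have "m * 2 ^ (r * m') \<le> card (g -` {y} \<inter> C) * 2 ^ (r * m')"
    using C(3) y(2) cardW
    by (meson dual_order.trans mult_le_mono2 one_le_numeral power_increasing)
  then have "m \<le> card (g -` {y} \<inter> C)" by simp
  then obtain D where D: "D \<subseteq> g -` {y} \<inter> C" "card D = m" "finite D"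
    by (rule obtain_subset_with_card_n)
  then obtain v0 where v0: "v0 \<in> D" using \<open>m > 0\<close> by fastforce
  have "\<exists>T. T \<subseteq> y \<inter> U i \<and> card T = m" if i: "i < r" for i
  proof -
    have "y \<inter> U i = {u \<in> U i. adj \<kappa> (\<not> b) u v0}"
      using v0 D(1) i unfolding g_def W_def by blast
    then have "m \<le> card (y \<inter> U i)" using large[of v0 i] v0 D i by (auto simp: codeg_def)
    then show ?thesis using obtain_subset_with_card_n by metis
  qed
  then obtain T where T: "T i \<subseteq> y \<inter> U i" "card (T i) = m" if "i < r" for i
    by metis
  define U' where "U' i = (if i < r then T i else D)" for i
  have TU: "T i \<subseteq> U i" if "i < r" for i using T that by blast
  have TD: "adj \<kappa> (\<not> b) u v" if "u \<in> T i" "v \<in> D" "i < r" for u v i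
  proof -
    have "u \<in> y" "g v = y" using that T D by auto
    then show ?thesis by (auto simp: g_def)
  qed
  have DT: "adj \<kappa> (\<not> b) u v" if "u \<in> D" "v \<in> T i" "i < r" for u v i
    using TD[OF that(2,1,3)] adj_sym[of \<kappa>, OF sym] by metis
  have TT: "adj \<kappa> (\<not> b) u v" if "u \<in> T i" "v \<in> T j" "i < r" "j < r" "i \<noteq> j" for u v i j
    using U TU that unfolding clique_system_def by blast
  have "clique_system \<kappa> b (Suc r) m V U'"
    unfolding clique_system_def
  proof (intro conjI allI impI ballI)
    fix i assume i: "i < Suc r"
    show "U' i \<subseteq> V" "card (U' i) = m"
      using T TU UV D C by (auto simp: U'_def) blast+
    show "mono_clique \<kappa> b (U' i)"
    proof (cases "i < r")
      case True
      then show ?thesis using mono_clique_subset[OF UV(3) TU] by (simp add: U'_def)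
    next
      case False
      then show ?thesis using mono_clique_subset[OF C(2), of D] D by (simp add: U'_def)
    qed
  next
    fix i j u v assume ij: "i < Suc r" "j < Suc r" "i \<noteq> j" and uv: "u \<in> U' i" "v \<in> U' j"
    then show "adj \<kappa> (\<not> b) u v"
      using TT TD DT by (auto simp: U'_def less_Suc_eq split: if_splits)
  qed
  then show ?thesis by (rule that)
qed

text \<open>Each vertex of \<open>B\<close> has density at least 1 - \<delta> in colour
  \<open>b\<close> to some member, so it contributes at least (1 - \<delta>)^k to the power sums
  that \<open>sum_codeg_power_le\<close> bounds for each of the \<open>r\<close> members.\<close>

lemma card_mostly_adjacent_le:
  fixes \<alpha> \<delta> q :: real
  assumes V: "finite V" and U: "clique_system \<kappa> b r m V U" and "m > 0"
    and bound: "book_bounded \<kappa> b k V (\<alpha> * card V)" and "0 \<le> \<alpha>" and "\<delta> < 1"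
    and q: "\<alpha> + real k ^ 2 / m \<le> (1 - \<delta>) ^ k * q"
    and B: "B \<subseteq> V" "\<And>v. v \<in> B \<Longrightarrow> \<exists>i<r. v \<notin> U i \<and> codeg \<kappa> (\<not> b) (U i) v \<le> \<delta> * m"
  shows "card B \<le> r * q * card V"
proof -
  have UV: "U i \<subseteq> V" "card (U i) = m" "mono_clique \<kappa> b (U i)" if "i < r" for i
    using U that unfolding clique_system_def by auto
  have finB: "finite B" using B V finite_subset by blast
  have ge: "(1 - \<delta>) ^ k \<le> (\<Sum>i<r. (real (codeg \<kappa> b (U i) v) / m) ^ k)" if v: "v \<in> B" for v
  proof -
    obtain i where i: "i < r" "v \<notin> U i" "codeg \<kappa> (\<not> b) (U i) v \<le> \<delta> * m" using B v by blast
    have "codeg \<kappa> b (U i) v + codeg \<kappa> (\<not> b) (U i) v = m"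
      using codeg_add_codeg[of "U i" v \<kappa> b] i UV V finite_subset by metis
    then have "real (codeg \<kappa> b (U i) v) = m - real (codeg \<kappa> (\<not> b) (U i) v)" by linarith
    then have "(1 - \<delta>) * m \<le> codeg \<kappa> b (U i) v" using i by (simp add: algebra_simps)
    then have "1 - \<delta> \<le> real (codeg \<kappa> b (U i) v) / m" using \<open>m > 0\<close> by (simp add: field_simps)
    then have "(1 - \<delta>) ^ k \<le> (real (codeg \<kappa> b (U i) v) / m) ^ k"
      using assms by (intro power_mono) auto
    also have "\<dots> \<le> (\<Sum>i<r. (real (codeg \<kappa> b (U i) v) / m) ^ k)"
      by (rule member_le_sum) (use i in auto)
    finally show ?thesis .
  qed
  have "(1 - \<delta>) ^ k * card B = (\<Sum>v\<in>B. (1 - \<delta>) ^ k)" by simp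
  also have "\<dots> \<le> (\<Sum>v\<in>B. \<Sum>i<r. (real (codeg \<kappa> b (U i) v) / m) ^ k)"
    by (intro sum_mono ge)
  also have "\<dots> \<le> (\<Sum>v\<in>V. \<Sum>i<r. (real (codeg \<kappa> b (U i) v) / m) ^ k)"
    by (intro sum_mono2) (use V B in \<open>auto intro!: sum_nonneg\<close>)
  also have "\<dots> = (\<Sum>i<r. \<Sum>v\<in>V. (real (codeg \<kappa> b (U i) v) / m) ^ k)"
    by (rule sum.swap)
  also have "\<dots> \<le> (\<Sum>i<r. \<alpha> * card V + real k ^ 2 / m * card V)"
    by (intro sum_mono sum_codeg_power_le) (use UV V assms in auto)
  also have "\<dots> = r * (\<alpha> + real k ^ 2 / m) * card V" by (simp add: algebra_simps)
  also have "\<dots> \<le> r * ((1 - \<delta>) ^ k * q) * card V"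
    using q by (intro mult_right_mono mult_left_mono) auto
  finally have "(1 - \<delta>) ^ k * card B \<le> (1 - \<delta>) ^ k * (r * q * card V)" by (simp add: algebra_simps)
  then show ?thesis using \<open>\<delta> < 1\<close> by (simp add: mult_le_cancel_left)
qed

text \<open>Induction on \<open>r\<close> for all \<open>m\<close> at once, because an extension
  shrinks the members from a larger size m' to \<open>m\<close>. All sizes are fixed before
  \<open>V\<close> and \<open>\<kappa>\<close>, so that \<open>M\<close> is uniform. The gap between
  \<open>\<alpha>\<close> and \<open>q\<close> pays for both error terms.\<close>

lemma clique_system_or_sparse:
  fixes \<alpha> q :: real
  assumes k: "k > 0" and \<alpha>: "0 \<le> \<alpha>" "\<alpha> < q" and "r \<le> k" "m > 0"
  shows "\<exists>M. \<forall>V \<kappa>. finite (V :: 'a set) \<longrightarrow> (\<forall>u v. \<kappa> u v = \<kappa> v u) \<longrightarrow>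
     book_bounded \<kappa> b k V (\<alpha> * card V) \<longrightarrow>
     (\<exists>U. clique_system \<kappa> b r m V U) \<or>
     (\<exists>A\<subseteq>V. (1 - (real k - 1) * q) * card V - real M \<le> real (card A) \<and>
        (\<forall>C\<subseteq>A. mono_clique \<kappa> b C \<longrightarrow> card C < M))"
  using \<open>r \<le> k\<close> \<open>m > 0\<close>
proof (induction r arbitrary: m)
  case 0
  then show ?case by (auto simp: clique_system_def)
next
  case (Suc r)
  \<comment> \<open>By Bernoulli's inequality, this value keeps (1 - \<delta>)^k * q above the
    midpoint of \<open>\<alpha>\<close> and \<open>q\<close>.\<close>
  define \<delta> where "\<delta> = (q - \<alpha>) / (2 * k * q)"
  have q: "q > 0" using \<alpha> by linarith
  have \<delta>: "0 < \<delta>" "\<delta> < 1"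
  proof -
    show "0 < \<delta>" using \<alpha> q k by (simp add: \<delta>_def)
    have "q * 1 < q * (2 * real k)" using k q by (intro mult_strict_left_mono) auto
    then have "q - \<alpha> < q * (2 * real k)" using \<alpha> by linarith
    then have "q - \<alpha> < 2 * k * q" by (simp only: mult.commute)
    then show "\<delta> < 1" using q k by (simp add: \<delta>_def)
  qed
  have half: "(q + \<alpha>) / 2 \<le> (1 - \<delta>) ^ k * q"
  proof -
    have "1 + real k * (- \<delta>) \<le> (1 + (- \<delta>)) ^ k"
      by (rule Bernoulli_inequality) (use \<delta> in simp)
    then have "(1 - real k * \<delta>) * q \<le> (1 - \<delta>) ^ k * q" using q by simp
    also have "(1 - real k * \<delta>) * q = (q + \<alpha>) / 2" using q k by (simp add: \<delta>_def field_simps)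
    finally show ?thesis .
  qed
  \<comment> \<open>The first bound turns a density of at least \<delta> into at least
    \<open>m\<close> neighbours; the second makes k^2/m' at most the other half of the gap.\<close>
  define m' where "m' = nat \<lceil>max (m / \<delta>) (2 * real k ^ 2 / (q - \<alpha>))\<rceil>"
  have m': "m / \<delta> \<le> m'" "2 * real k ^ 2 / (q - \<alpha>) \<le> m'"
    unfolding m'_def by linarith+
  have "0 < m / \<delta>" using \<delta> Suc.prems by simp
  then have m'0: "m' > 0" using m'(1) by (metis gr0I of_nat_0 not_le)
  have m'1: "m \<le> \<delta> * m'" using m' \<delta> by (simp add: field_simps)
  have m'2: "\<alpha> + real k ^ 2 / m' \<le> (1 - \<delta>) ^ k * q"
  proof -
    have "2 * real k ^ 2 \<le> m' * (q - \<alpha>)" using m'(2) \<alpha> by (simp add: field_simps)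
    then have "real k ^ 2 / m' \<le> (q - \<alpha>) / 2" using m'0 by (simp add: field_simps)
    then show ?thesis using half by (simp add: field_simps)
  qed
  obtain M1 where M1: "\<forall>V \<kappa>. finite (V :: 'a set) \<longrightarrow> (\<forall>u v. \<kappa> u v = \<kappa> v u) \<longrightarrow>
     book_bounded \<kappa> b k V (\<alpha> * card V) \<longrightarrow>
     (\<exists>U. clique_system \<kappa> b r m' V U) \<or>
     (\<exists>A\<subseteq>V. (1 - (real k - 1) * q) * card V - real M1 \<le> real (card A) \<and>
        (\<forall>C\<subseteq>A. mono_clique \<kappa> b C \<longrightarrow> card C < M1))"
    using Suc.IH[OF Suc_leD[OF Suc.prems(1)] m'0] by (rule exE)
  \<comment> \<open>\<open>M1\<close> serves the inductive case, r * m' bounds the discarded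
    vertices of the cliques themselves, and the last term is the clique size needed for an
    extension.\<close>
  define M where "M = max M1 (max (r * m') (m * 2 ^ (r * m')))"
  show ?case
  proof (intro exI[of _ M] allI impI)
    fix V :: "'a set" and \<kappa>
    assume V: "finite V" and sym: "\<forall>u v. \<kappa> u v = \<kappa> v u"
      and bound: "book_bounded \<kappa> b k V (\<alpha> * card V)"
    let ?goal = "(\<exists>U. clique_system \<kappa> b (Suc r) m V U) \<or>
       (\<exists>A\<subseteq>V. (1 - (real k - 1) * q) * card V - real M \<le> real (card A) \<and>
        (\<forall>C\<subseteq>A. mono_clique \<kappa> b C \<longrightarrow> card C < M))"
    consider U where "clique_system \<kappa> b r m' V U"
      | A where "A \<subseteq> V" "(1 - (real k - 1) * q) * card V - real M1 \<le> real (card A)"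
        "\<And>C. C \<subseteq> A \<Longrightarrow> mono_clique \<kappa> b C \<Longrightarrow> card C < M1"
      using M1[rule_format, OF V sym[rule_format] bound] by blast
    then show ?goal
    proof cases
      case 2
      have "M1 \<le> M" by (simp add: M_def)
      then have "\<forall>C\<subseteq>A. mono_clique \<kappa> b C \<longrightarrow> card C < M" using 2(3) by (meson order_less_le_trans)
      moreover have "(1 - (real k - 1) * q) * card V - real M \<le> real (card A)"
        using 2(2) \<open>M1 \<le> M\<close> by linarith
      ultimately show ?thesis using 2(1) by blast
    next
      case 1
      have UV: "U i \<subseteq> V" "card (U i) = m'" if "i < r" for i
        using 1 that unfolding clique_system_def by auto
      define W where "W = (\<Union>i<r. U i)"
      define A where "A = {v \<in> V - W. \<forall>i<r. \<delta> * m' < codeg \<kappa> (\<not> b) (U i) v}"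
      define B where "B = {v \<in> V - W. \<exists>i<r. codeg \<kappa> (\<not> b) (U i) v \<le> \<delta> * m'}"
      have WV: "W \<subseteq> V" unfolding W_def using UV by blast
      have "card W \<le> (\<Sum>i<r. card (U i))" unfolding W_def by (rule card_UN_le) simp
      also have "\<dots> = r * m'" using UV by simp
      finally have cardW: "card W \<le> M" by (simp add: M_def)
      have cardB: "card B \<le> r * q * card V"
        by (rule card_mostly_adjacent_le[OF V 1 m'0 bound _ _ m'2])
          (use \<alpha> \<delta> in \<open>auto simp: B_def W_def\<close>)
      also have "\<dots> \<le> (real k - 1) * q * card V"
        using Suc.prems q by (intro mult_right_mono) auto
      finally have cardB: "card B \<le> (real k - 1) * q * card V" .
      have "V = A \<union> B \<union> W" using WV by (auto simp: A_def B_def not_less)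
      then have "card V \<le> card A + card B + card W"
        by (metis card_Un_le add_le_mono1 le_trans)
      then have cardA: "(1 - (real k - 1) * q) * card V - real M \<le> real (card A)"
        using cardB cardW by (simp add: algebra_simps)
      show ?thesis
      proof (cases "\<forall>C\<subseteq>A. mono_clique \<kappa> b C \<longrightarrow> card C < M")
        case True
        then show ?thesis using cardA by (intro disjI2 exI[of _ A]) (auto simp: A_def)
      next
        case False
        then obtain C where C: "C \<subseteq> A" "mono_clique \<kappa> b C" "M \<le> card C" by (meson not_le)
        have "m \<le> codeg \<kappa> (\<not> b) (U i) v" if "v \<in> C" "i < r" for v i
        proof -
          have "\<delta> * m' < codeg \<kappa> (\<not> b) (U i) v" using that C by (auto simp: A_def)
          then show ?thesis using m'1 by linarith
        qed
        obtain U' where U': "clique_system \<kappa> b (Suc r) m V U'"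
        proof (rule clique_system_extend[of \<kappa> V b r m' U m C])
          show "m * 2 ^ (r * m') \<le> card C" using C by (simp add: M_def)
        qed (use sym V 1 C Suc.prems \<open>\<And>v i. v \<in> C \<Longrightarrow> i < r \<Longrightarrow> m \<le> codeg \<kappa> (\<not> b) (U i) v\<close>
            in \<open>auto simp: A_def\<close>)
        then show ?thesis by blast
      qed
    qed
  qed
qed

text \<open>Sum \<open>book_ineq\<close> over all vertices outside the system, with \<open>x\<close>
  as the densities in colour \<open>b\<close>. The power sums are bounded by books inside the
  members and the products by books on transversals. The k * m vertices of the system are left out,
  since their two densities to a member need not add up to 1.\<close>

lemma clique_system_ineq:
  fixes \<alpha> \<beta> p :: real
  assumes V: "finite V" and U: "clique_system \<kappa> b k m V U" and "m > 0" "k > 0"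
    and b1: "book_bounded \<kappa> b k V (\<alpha> * card V)" "0 \<le> \<alpha>"
    and b2: "book_bounded \<kappa> (\<not> b) k V (\<beta> * card V)"
    and p: "0 < p" "p < 1" and ineq: "book_ineq k p"
  shows "p ^ (k - 1) * (real (card V) - k * m) \<le>
    (\<alpha> + real k ^ 2 / m + (p / (1 - p)) ^ (k - 1) * \<beta>) * card V"
proof -
  have UV: "U i \<subseteq> V" "card (U i) = m" "mono_clique \<kappa> b (U i)" if "i < k" for i
    using U that unfolding clique_system_def by auto
  have finU: "finite (U i)" if "i < k" for i using UV V that finite_subset by blast
  define W where "W = (\<Union>i<k. U i)"
  define x y where "x v i = real (codeg \<kappa> b (U i) v) / m"
    and "y v i = real (codeg \<kappa> (\<not> b) (U i) v) / m" for v i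
  define R where "R = (p / (1 - p)) ^ (k - 1)"
  have R: "R \<ge> 0" using p by (simp add: R_def)
  have "card W \<le> (\<Sum>i<k. card (U i))" unfolding W_def by (rule card_UN_le) simp
  also have "\<dots> = k * m" using UV by simp
  finally have cardW: "card W \<le> k * m" .
  have WV: "W \<subseteq> V" unfolding W_def using UV by blast
  have pt: "p ^ (k - 1) \<le> (\<Sum>i<k. x v i ^ k) / k + R * (\<Prod>i<k. y v i)" if v: "v \<in> V - W" for v
  proof -
    have y: "y v i = 1 - x v i" if i: "i < k" for i
    proof -
      have "codeg \<kappa> b (U i) v + codeg \<kappa> (\<not> b) (U i) v = m"
        using codeg_add_codeg[OF finU[OF i], of v \<kappa> b] i UV v by (auto simp: W_def)
      then have "real (codeg \<kappa> (\<not> b) (U i) v) = m - real (codeg \<kappa> b (U i) v)" by linarith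
      then show ?thesis using \<open>m > 0\<close> by (simp add: x_def y_def field_simps)
    qed
    have "0 \<le> x v i \<and> x v i \<le> 1" if i: "i < k" for i
      using codeg_le[OF finU[OF i], of \<kappa> b v] i UV \<open>m > 0\<close> by (simp add: x_def)
    then have "p ^ (k - 1) \<le> (\<Sum>i<k. x v i ^ k) / k + R * (\<Prod>i<k. 1 - x v i)"
      using ineq unfolding book_ineq_def R_def by blast
    then show ?thesis using y by simp
  qed
  have "real (card V) - k * m \<le> card V - real (card W)" using cardW by (simp flip: of_nat_mult)
  also have "\<dots> = card (V - W)"
    using WV V by (metis card_Diff_subset card_mono finite_subset of_nat_diff)
  finally have "p ^ (k - 1) * (real (card V) - k * m) \<le> p ^ (k - 1) * card (V - W)"
    using p by (intro mult_left_mono) auto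
  also have "\<dots> = (\<Sum>v\<in>V - W. p ^ (k - 1))" by simp
  also have "\<dots> \<le> (\<Sum>v\<in>V - W. (\<Sum>i<k. x v i ^ k) / k + R * (\<Prod>i<k. y v i))"
    by (intro sum_mono pt)
  also have "\<dots> \<le> (\<Sum>v\<in>V. (\<Sum>i<k. x v i ^ k) / k + R * (\<Prod>i<k. y v i))"
    by (intro sum_mono2)
      (use V R in \<open>auto simp: x_def y_def intro!: sum_nonneg add_nonneg_nonneg prod_nonneg mult_nonneg_nonneg divide_nonneg_nonneg\<close>)
  also have "\<dots> = (\<Sum>i<k. \<Sum>v\<in>V. x v i ^ k) / k + R * (\<Sum>v\<in>V. \<Prod>i<k. y v i)"
    by (simp add: sum.distrib sum_distrib_left sum.swap[of _ "{..<k}"] flip: sum_divide_distrib)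
  also have "\<dots> \<le> (\<Sum>i<k. \<alpha> * card V + real k ^ 2 / m * card V) / k + R * (\<beta> * card V)"
    unfolding x_def y_def
    by (intro add_mono divide_right_mono sum_mono mult_left_mono sum_codeg_power_le sum_prod_codeg_le)
      (use UV V \<open>m > 0\<close> b1 b2 R U in \<open>auto simp: clique_system_def\<close>)
  also have "\<dots> = (\<alpha> + real k ^ 2 / m + R * \<beta>) * card V"
    using \<open>k > 0\<close> by (simp add: field_simps)
  finally show ?thesis by (simp add: R_def)
qed

text \<open>Ramsey's theorem with a separate size for each colour, since the sparse sets of the two
  colours come with different constants.\<close>

lemma monochromatic_clique_exists:
  "\<exists>r. \<forall>(V :: 'a set) \<kappa>. finite V \<longrightarrow> r \<le> card V \<longrightarrow> (\<forall>u v. \<kappa> u v = \<kappa> v u) \<longrightarrow>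
     (\<exists>C\<subseteq>V. \<exists>b. card C = m b \<and> mono_clique \<kappa> b C)"
proof -
  obtain r where r: "\<And>(V :: 'a set) E. finite V \<Longrightarrow> card V \<ge> r \<Longrightarrow>
    (\<exists>R \<subseteq> V. card R = m True \<and> clique R E \<or> card R = m False \<and> indep R E)"
    using ramsey2[of "m True" "m False"] by blast
  show ?thesis
  proof (intro exI[of _ r] allI impI)
    fix V :: "'a set" and \<kappa> :: "'a \<Rightarrow> 'a \<Rightarrow> bool"
    assume V: "finite V" "r \<le> card V" and sym: "\<forall>u v. \<kappa> u v = \<kappa> v u"
    define E where "E = {{u, v} | u v. \<kappa> u v}"
    have E: "{u, v} \<in> E \<longleftrightarrow> \<kappa> u v" for u v
      using sym by (auto simp: E_def doubleton_eq_iff)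
    obtain R where R: "R \<subseteq> V"
      "card R = m True \<and> clique R E \<or> card R = m False \<and> indep R E"
      using r[OF V] by blast
    then have "card R = m True \<and> mono_clique \<kappa> True R \<or> card R = m False \<and> mono_clique \<kappa> False R"
      by (auto simp: clique_def indep_def mono_clique_def E)
    then show "\<exists>C\<subseteq>V. \<exists>b. card C = m b \<and> mono_clique \<kappa> b C" using R by blast
  qed
qed

text \<open>Indexing by the colour handles \<open>p\<close> and 1 - p together. Suppose all books
  are small. A system of \<open>k\<close> cliques contradicts \<open>clique_system_ineq\<close> once
  \<open>V\<close> is large. Without one, both sparse sets exist, and by \<open>Pk\<close> their
  intersection is large; a monochromatic clique in it is then too big for the sparse set of its own
  colour.\<close>

lemma monochromatic_book_exists:
  fixes P \<alpha> :: "bool \<Rightarrow> real"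
  assumes k: "k \<ge> 2" and P: "\<And>b. 0 < P b" "P True + P False = 1"
    and Pk: "(real k - 1) * (P True ^ k + P False ^ k) < 1"
    and ineq: "\<And>b. book_ineq k (P b)"
    and \<alpha>: "\<And>b. 0 \<le> \<alpha> b" "\<And>b. \<alpha> b < P b ^ k"
  shows "\<exists>N0. \<forall>V \<kappa>. finite (V :: 'a set) \<longrightarrow> N0 \<le> card V \<longrightarrow> (\<forall>u v. \<kappa> u v = \<kappa> v u) \<longrightarrow>
    (\<exists>b. \<not> book_bounded \<kappa> b k V (\<alpha> b * card V))"
proof -
  have Pnot: "P (\<not> b) = 1 - P b" for b using P(2) by (cases b) auto
  have P1: "P b < 1" for b using P(1)[of "\<not> b"] Pnot[of b] by simp
  \<comment> \<open>The slack in \<open>clique_system_ineq\<close> apart from its error terms. It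
    would be 0 if every \<open>\<alpha> b\<close> were equal to P b ^ k.\<close>
  define \<gamma> where "\<gamma> b = P b ^ (k - 1) - \<alpha> b - (P b / (1 - P b)) ^ (k - 1) * \<alpha> (\<not> b)" for b
  have \<gamma>: "\<gamma> b > 0" for b
  proof -
    have "(P b / (1 - P b)) ^ (k - 1) * \<alpha> (\<not> b) \<le> (P b / (1 - P b)) ^ (k - 1) * (1 - P b) ^ k"
      using \<alpha>(2)[of "\<not> b"] P(1)[of b] P1[of b] by (intro mult_left_mono) (auto simp: Pnot)
    also have "(1 - P b) ^ k = (1 - P b) ^ (k - 1) * (1 - P b)"
      using k by (metis Suc_diff_1 less_le_trans mult.commute pos2 power_Suc)
    also have "(P b / (1 - P b)) ^ (k - 1) * ((1 - P b) ^ (k - 1) * (1 - P b)) = P b ^ (k - 1) * (1 - P b)"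
      using P1[of b] by (simp add: power_divide)
    finally have "(P b / (1 - P b)) ^ (k - 1) * \<alpha> (\<not> b) \<le> P b ^ (k - 1) * (1 - P b)" .
    moreover have "\<alpha> b < P b ^ (k - 1) * P b"
      using \<alpha>(2)[of b] k by (metis Suc_diff_1 less_le_trans mult.commute pos2 power_Suc)
    ultimately show ?thesis by (simp add: \<gamma>_def algebra_simps)
  qed
  define \<gamma>0 where "\<gamma>0 = min (\<gamma> True) (\<gamma> False)"
  have \<gamma>0: "\<gamma>0 > 0" "\<gamma>0 \<le> \<gamma> b" for b using \<gamma> by (cases b; simp add: \<gamma>0_def)+
  \<comment> \<open>With this size, the error k^2/m uses at most half of the slack.\<close>
  define m where "m = Suc (nat \<lceil>2 * real k ^ 2 / \<gamma>0\<rceil>)"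
  have m: "m > 0" "2 * real k ^ 2 / \<gamma>0 \<le> m" unfolding m_def by linarith+
  have m2: "real k ^ 2 / m \<le> \<gamma>0 / 2" using m \<gamma>0 by (simp add: field_simps)
  have "\<exists>M. \<forall>V \<kappa>. finite (V :: 'a set) \<longrightarrow> (\<forall>u v. \<kappa> u v = \<kappa> v u) \<longrightarrow>
     book_bounded \<kappa> b k V (\<alpha> b * card V) \<longrightarrow>
     (\<exists>U. clique_system \<kappa> b k m V U) \<or>
     (\<exists>A\<subseteq>V. (1 - (real k - 1) * P b ^ k) * card V - real M \<le> real (card A) \<and>
        (\<forall>C\<subseteq>A. mono_clique \<kappa> b C \<longrightarrow> card C < M))" for b
    using k \<alpha> m by (intro clique_system_or_sparse) auto
  then obtain M where M: "\<And>b V \<kappa>. finite (V :: 'a set) \<Longrightarrow> (\<forall>u v. \<kappa> u v = \<kappa> v u) \<Longrightarrow>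
     book_bounded \<kappa> b k V (\<alpha> b * card V) \<Longrightarrow>
     (\<exists>U. clique_system \<kappa> b k m V U) \<or>
     (\<exists>A\<subseteq>V. (1 - (real k - 1) * P b ^ k) * card V - real (M b) \<le> real (card A) \<and>
        (\<forall>C\<subseteq>A. mono_clique \<kappa> b C \<longrightarrow> card C < M b))"
    by metis
  obtain r where r: "\<And>(V :: 'a set) \<kappa>. finite V \<Longrightarrow> r \<le> card V \<Longrightarrow> (\<forall>u v. \<kappa> u v = \<kappa> v u) \<Longrightarrow>
     (\<exists>C\<subseteq>V. \<exists>b. card C = M b \<and> mono_clique \<kappa> b C)"
    using monochromatic_clique_exists[of M] by metis
  define s where "s = 1 - (real k - 1) * (P True ^ k + P False ^ k)"
  have s: "s > 0" using Pk by (simp add: s_def)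
  \<comment> \<open>The first bound leaves at least \<open>r\<close> vertices in the intersection of
    the two sparse sets; the second rules out a system of \<open>k\<close> cliques, and
    \<open>Suc\<close> makes it strict.\<close>
  define N0 where "N0 = Suc (nat \<lceil>max ((real r + M True + M False) / s) (2 * k * m / \<gamma>0)\<rceil>)"
  have N0: "(real r + M True + M False) / s \<le> N0" "2 * k * m / \<gamma>0 < N0"
    unfolding N0_def by linarith+
  show ?thesis
  proof (intro exI[of _ N0] allI impI, rule ccontr)
    fix V :: "'a set" and \<kappa> :: "'a \<Rightarrow> 'a \<Rightarrow> bool"
    assume V: "finite V" "N0 \<le> card V" and sym: "\<forall>u v. \<kappa> u v = \<kappa> v u"
      and "\<nexists>b. \<not> book_bounded \<kappa> b k V (\<alpha> b * card V)"
    then have bound: "book_bounded \<kappa> b k V (\<alpha> b * card V)" for b by blast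
    show False
    proof (cases "\<exists>b U. clique_system \<kappa> b k m V U")
      case True
      then obtain b U where U: "clique_system \<kappa> b k m V U" by blast
      have "P b ^ (k - 1) * (real (card V) - k * m) \<le>
          (\<alpha> b + real k ^ 2 / m + (P b / (1 - P b)) ^ (k - 1) * \<alpha> (\<not> b)) * card V"
        using k m \<alpha> P(1) P1
        by (intro clique_system_ineq[OF V(1) U _ _ bound _ bound]) (auto simp: ineq)
      also have "\<dots> \<le> (P b ^ (k - 1) - \<gamma>0 / 2) * card V"
      proof (rule mult_right_mono)
        show "\<alpha> b + real k ^ 2 / m + (P b / (1 - P b)) ^ (k - 1) * \<alpha> (\<not> b) \<le> P b ^ (k - 1) - \<gamma>0 / 2"
          using m2 \<gamma>0(2)[of b] unfolding \<gamma>_def by linarith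
      qed simp
      finally have "\<gamma>0 / 2 * card V \<le> P b ^ (k - 1) * (real k * m)" by (simp add: algebra_simps)
      also have "\<dots> \<le> 1 * (real k * m)"
        using P(1)[of b] P1[of b] by (intro mult_right_mono power_le_one) auto
      finally have "card V \<le> 2 * k * m / \<gamma>0" using \<gamma>0(1) by (simp add: field_simps)
      then show False using N0(2) V(2) by linarith
    next
      case False
      have "\<exists>A\<subseteq>V. (1 - (real k - 1) * P b ^ k) * card V - real (M b) \<le> real (card A) \<and>
        (\<forall>C\<subseteq>A. mono_clique \<kappa> b C \<longrightarrow> card C < M b)" for b
        using M[OF V(1) sym bound] False by blast
      then obtain A where A: "\<And>b. A b \<subseteq> V"
        "\<And>b. (1 - (real k - 1) * P b ^ k) * card V - real (M b) \<le> real (card (A b))"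
        "\<And>b C. C \<subseteq> A b \<Longrightarrow> mono_clique \<kappa> b C \<Longrightarrow> card C < M b"
        by metis
      have fin: "finite (A b)" for b using A V finite_subset by blast
      have "card (A True) + card (A False) = card (A True \<union> A False) + card (A True \<inter> A False)"
        by (intro card_Un_Int fin)
      also have "card (A True \<union> A False) \<le> card V"
        using A V by (intro card_mono) auto
      finally have "card (A True) + card (A False) \<le> card V + card (A True \<inter> A False)" by simp
      then have "s * card V - M True - M False \<le> card (A True \<inter> A False)"
        using A(2)[of True] A(2)[of False] by (simp add: s_def algebra_simps)
      moreover have "real r + M True + M False \<le> s * card V"
      proof -
        have "real r + M True + M False \<le> s * N0" using N0(1) s by (simp add: field_simps)
        also have "\<dots> \<le> s * card V" using V s by simp
        finally show ?thesis .
      qed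
      ultimately have "r \<le> card (A True \<inter> A False)" by linarith
      then obtain C b where C: "C \<subseteq> A True \<inter> A False" "card C = M b" "mono_clique \<kappa> b C"
        using r[of "A True \<inter> A False" \<kappa>] fin sym by blast
      then have "C \<subseteq> A b" by (cases b) auto
      then show False using A(3)[OF _ C(3)] C(2) by simp
    qed
  qed
qed

section \<open>Random colourings\<close>

lemma bernoulli_prob_singleton:
  "0 \<le> p \<Longrightarrow> p \<le> 1 \<Longrightarrow> measure_pmf.prob (bernoulli_pmf p) {b} = (if b then p else 1 - p)"
  by (simp add: measure_pmf_single)

text \<open>For a fixed spine \<open>K\<close>, the events that the vertices outside
  \<open>K\<close> are pages depend on disjoint sets of edges. They are independent of probability
  q^k, and Hoeffding's inequality applies.\<close>

lemma prob_pages_ge: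
  fixes p \<eta> :: real and K V :: "'a set"
  assumes p: "0 \<le> p" "p \<le> 1" and V: "finite V" "K \<subseteq> V" "card K = k" "K \<noteq> V" and \<eta>: "\<eta> \<ge> 0"
    and q: "q = (if b then p else 1 - p)"
  shows "measure_pmf.prob (Pi_pmf ([V]\<^bsup>2\<^esup>) False (\<lambda>_. bernoulli_pmf p))
      {f. (q ^ k + \<eta>) * card V \<le> card (pages (\<lambda>u v. f {u, v}) b V K)} \<le> exp (- 2 * \<eta>\<^sup>2 * card V)"
proof -
  define I where "I = V - K"
  define E where "E = [V]\<^bsup>2\<^esup>"
  define M where "M = Pi_pmf E False (\<lambda>_. bernoulli_pmf p)"
  define L where "L v = (\<lambda>u. {u, v}) ` K" for v
  define X :: "'a \<Rightarrow> ('a set \<Rightarrow> bool) \<Rightarrow> real" where "X v f = of_bool (\<forall>e\<in>L v. f e = b)" for v f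
  define Y :: "'a \<Rightarrow> ('a set \<Rightarrow> bool) \<Rightarrow> real" where "Y v h = of_bool (\<forall>e\<in>L v. h e = b)" for v h
  have finK: "finite K" using V finite_subset by blast
  have finI: "finite I" using V by (simp add: I_def)
  have finE: "finite E" unfolding E_def by (simp add: V(1) finite_imp_finite_nsets)
  have finL: "finite (L v)" for v using finK by (simp add: L_def)
  have LE: "L v \<subseteq> E" if "v \<in> I" for v
    using that V unfolding L_def E_def I_def nsets_2_eq by auto
  have cardL: "card (L v) = k" for v
    unfolding L_def V(3)[symmetric] by (intro card_image) (auto simp: inj_on_def doubleton_eq_iff)
  have disj: "disjoint_family_on L I"
    by (auto simp: disjoint_family_on_def L_def I_def doubleton_eq_iff)
  have "prob_space.indep_vars (measure_pmf M) (\<lambda>_. count_space UNIV) (\<lambda>x f. f x) E"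
    unfolding M_def using finE by (rule indep_vars_Pi_pmf)
  then have "prob_space.indep_vars (measure_pmf M) (\<lambda>v. PiM (L v) (\<lambda>_. count_space UNIV)) (\<lambda>v f. restrict (\<lambda>e. f e) (L v)) I"
    by (rule prob_space.indep_vars_restrict[OF measure_pmf.prob_space_axioms _ LE disj])
  \<comment> \<open>\<open>Y v\<close> is \<open>X v\<close> as a function of the colours on
    \<open>L v\<close> alone, so the independence of these blocks passes to the indicators.\<close>
  then have "prob_space.indep_vars (measure_pmf M) (\<lambda>_. borel) (\<lambda>v f. Y v (restrict (\<lambda>e. f e) (L v))) I"
  proof (rule prob_space.indep_vars_compose2[OF measure_pmf.prob_space_axioms, where Y = Y])
    show "Y v \<in> borel_measurable (Pi\<^sub>M (L v) (\<lambda>_. count_space UNIV))" for v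
      unfolding Y_def using finL[of v] by measurable
  qed
  then have indep: "prob_space.indep_vars (measure_pmf M) (\<lambda>_. borel) X I"
    by (simp add: X_def[abs_def] Y_def)
  have EX: "measure_pmf.expectation M (X v) = q ^ k" if v: "v \<in> I" for v
  proof -
    have "X v = indicator (Pi E (\<lambda>e. if e \<in> L v then {b} else UNIV))"
      using LE[OF v] by (auto simp: X_def indicator_def fun_eq_iff Pi_iff)
    then have "measure_pmf.expectation M (X v) = measure M (Pi E (\<lambda>e. if e \<in> L v then {b} else UNIV))"
      by simp
    also have "\<dots> = (\<Prod>e\<in>E. measure (bernoulli_pmf p) (if e \<in> L v then {b} else UNIV))"
      unfolding M_def by (rule measure_Pi_pmf_Pi) (rule finE)
    also have "\<dots> = (\<Prod>e\<in>E. if e \<in> L v then q else 1)"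
      using p q by (intro prod.cong) (auto simp: bernoulli_prob_singleton)
    also have "\<dots> = (\<Prod>e\<in>E \<inter> L v. q)"
      by (rule prod.inter_restrict[OF finE, symmetric])
    also have "E \<inter> L v = L v" using LE[OF v] by blast
    finally show ?thesis by (simp add: cardL)
  qed
  interpret Hoeffding_ineq "measure_pmf M" I X "\<lambda>_. 0" "\<lambda>_. 1" "\<Sum>i\<in>I. measure_pmf.expectation M (X i)"
    by unfold_locales (use finI indep in \<open>auto simp: X_def\<close>)
  \<comment> \<open>\<open>card I\<close> is the denominator in Hoeffding's exponent; it is positive
    because of K \<noteq> V.\<close>
  have I: "card I > 0" "card I \<le> card V"
    using V finI by (auto simp: I_def card_gt_0_iff intro!: card_mono)
  have "q ^ k \<ge> 0" using p q by simp
  have "{f. (q ^ k + \<eta>) * card V \<le> card (pages (\<lambda>u v. f {u, v}) b V K)}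
      \<subseteq> {f \<in> space M. (\<Sum>i\<in>I. X i f) \<ge> (\<Sum>i\<in>I. measure_pmf.expectation M (X i)) + \<eta> * card V}"
  proof safe
    fix f assume f: "(q ^ k + \<eta>) * card V \<le> card (pages (\<lambda>u v. f {u, v}) b V K)"
    have "pages (\<lambda>u v. f {u, v}) b V K = {v \<in> I. \<forall>e\<in>L v. f e = b}"
      by (auto simp: pages_def adj_def I_def L_def)
    then have "real (card (pages (\<lambda>u v. f {u, v}) b V K)) = (\<Sum>i\<in>I. X i f)"
      using finI by (simp add: X_def of_bool_def flip: sum.inter_filter)
    moreover have "q ^ k * card I \<le> q ^ k * card V"
      using I \<open>q ^ k \<ge> 0\<close> by (intro mult_left_mono) auto
    ultimately show "(\<Sum>i\<in>I. measure_pmf.expectation M (X i)) + \<eta> * card V \<le> (\<Sum>i\<in>I. X i f)"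
      using f by (simp add: EX algebra_simps)
  qed simp
  then have "measure_pmf.prob M {f. (q ^ k + \<eta>) * card V \<le> card (pages (\<lambda>u v. f {u, v}) b V K)}
      \<le> measure_pmf.prob M {f \<in> space M. (\<Sum>i\<in>I. X i f) \<ge> (\<Sum>i\<in>I. measure_pmf.expectation M (X i)) + \<eta> * card V}"
    by (intro measure_pmf.finite_measure_mono) auto
  also have "\<dots> \<le> exp (- 2 * (\<eta> * card V)\<^sup>2 / (\<Sum>i\<in>I. (1 - 0)\<^sup>2))"
    by (rule Hoeffding_ineq_ge) (use \<eta> I in auto)
  also have "\<dots> \<le> exp (- 2 * \<eta>\<^sup>2 * card V)"
  proof -
    have "\<eta>\<^sup>2 * card V * card I \<le> \<eta>\<^sup>2 * card V * card V"
      using I by (intro mult_left_mono) auto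
    then have "\<eta>\<^sup>2 * card V \<le> (\<eta> * card V)\<^sup>2 / card I"
      using I by (simp add: field_simps power2_eq_square)
    then show ?thesis by simp
  qed
  finally show ?thesis by (simp add: M_def E_def)
qed

text \<open>A union bound over the at most 2 N^k pairs of a spine and a colour, against an
  exponentially small failure probability. All k-sets are covered, whether or not they are cliques.
  Colouring unordered pairs makes \<open>\<kappa>\<close> symmetric.\<close>

lemma quasirandom_coloring_exists:
  fixes p \<eta> :: real
  assumes p: "0 \<le> p" "p \<le> 1" and \<eta>: "\<eta> > 0"
  shows "\<exists>N0. \<forall>N::nat\<ge>N0. \<exists>\<kappa>. (\<forall>u v. \<kappa> u v = \<kappa> v u) \<and>
    (\<forall>b. \<forall>K\<subseteq>{..<N}. card K = k \<longrightarrow>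
      card (pages \<kappa> b {..<N} K) < ((if b then p else 1 - p) ^ k + \<eta>) * N)"
proof -
  have "eventually (\<lambda>N::nat. 2 * real N ^ k * exp (- 2 * \<eta>\<^sup>2 * real N) < 1) at_top"
    using \<eta> by real_asymp
  then obtain N1 where N1: "\<And>N. N \<ge> N1 \<Longrightarrow> 2 * real N ^ k * exp (- 2 * \<eta>\<^sup>2 * real N) < 1"
    by (auto simp: eventually_at_top_linorder)
  show ?thesis
  proof (intro exI[of _ "max N1 (Suc k)"] allI impI)
    fix N assume N: "max N1 (Suc k) \<le> N"
    define V where "V = {..<N}"
    define M where "M = Pi_pmf ([V]\<^bsup>2\<^esup>) False (\<lambda>_. bernoulli_pmf p)"
    define S where "S = {K. K \<subseteq> V \<and> card K = k} \<times> (UNIV :: bool set)"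
    define bad where "bad = (\<lambda>(K, b). {f. ((if b then p else 1 - p) ^ k + \<eta>) * card V
        \<le> card (pages (\<lambda>u v. f {u, v}) b V K)})"
    have V: "finite V" "card V = N" by (auto simp: V_def)
    have finS: "finite S" using V by (auto simp: S_def intro: finite_subset[of _ "Pow V"])
    have "card S = (N choose k) * 2" using n_subsets[OF V(1), of k] V by (simp add: S_def)
    also have "\<dots> \<le> N ^ k * 2" using N by (intro mult_right_mono binomial_le_pow) auto
    finally have cardS: "card S \<le> 2 * N ^ k" by simp
    have "measure_pmf.prob M (\<Union>s\<in>S. bad s) \<le> (\<Sum>s\<in>S. measure_pmf.prob M (bad s))"
      using finS by (intro measure_pmf.finite_measure_subadditive_finite) auto
    also have "\<dots> \<le> (\<Sum>s\<in>S. exp (- 2 * \<eta>\<^sup>2 * card V))"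
    proof (rule sum_mono)
      fix s assume "s \<in> S"
      then obtain K b where s: "s = (K, b)" "K \<subseteq> V" "card K = k" by (auto simp: S_def)
      then have "K \<noteq> V" using N V by auto
      then show "measure_pmf.prob M (bad s) \<le> exp (- 2 * \<eta>\<^sup>2 * card V)"
        unfolding s bad_def M_def prod.case using s \<eta> V p by (intro prob_pages_ge) auto
    qed
    also have "\<dots> = real (card S) * exp (- 2 * \<eta>\<^sup>2 * N)" by (simp add: V)
    also have "\<dots> \<le> real (2 * N ^ k) * exp (- 2 * \<eta>\<^sup>2 * N)"
      using cardS by (intro mult_right_mono) (auto simp only: of_nat_le_iff exp_ge_zero)
    also have "\<dots> < 1" using N1[of N] N by simp
    finally have "measure_pmf.prob M (\<Union>s\<in>S. bad s) < 1" .
    then have "(\<Union>s\<in>S. bad s) \<noteq> UNIV" by (metis measure_pmf.prob_space measure_pmf_UNIV less_irrefl)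
    then obtain f where "f \<notin> (\<Union>s\<in>S. bad s)" by blast
    then have f: "f \<notin> bad (K, b)" if "K \<subseteq> V" "card K = k" for K b
      using that by (auto simp: S_def)
    show "\<exists>\<kappa>. (\<forall>u v. \<kappa> u v = \<kappa> v u) \<and> (\<forall>b. \<forall>K\<subseteq>{..<N}. card K = k \<longrightarrow>
      card (pages \<kappa> b {..<N} K) < ((if b then p else 1 - p) ^ k + \<eta>) * N)"
      by (rule exI[of _ "\<lambda>u v. f {u, v}"])
        (use f in \<open>auto simp: bad_def V insert_commute not_le simp flip: V_def\<close>)
  qed
qed

section \<open>Ramsey numbers of books\<close>

text \<open>Every edge of the book has an endpoint below \<open>k\<close>, and copies need not be
  induced, so an embedding amounts to a clique as the image of \<open>{..<k}\<close> and
  \<open>n\<close> common neighbours of it.\<close>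

lemma contains_book_iff:
  assumes V: "finite V"
    and E: "\<And>u v. u \<in> V \<Longrightarrow> v \<in> V \<Longrightarrow> u \<noteq> v \<Longrightarrow> {u, v} \<in> E \<longleftrightarrow> \<kappa> u v = b"
  shows "contains_copy (V, E) (book_graph k n) \<longleftrightarrow>
    (\<exists>K\<subseteq>V. card K = k \<and> mono_clique \<kappa> b K \<and> n \<le> card (pages \<kappa> b V K))"
proof
  assume "contains_copy (V, E) (book_graph k n)"
  then obtain f where f: "inj_on f {..<k + n}" "f ` {..<k + n} \<subseteq> V"
    and fE: "\<And>e. e \<in> snd (book_graph k n) \<Longrightarrow> f ` e \<in> E"
    unfolding contains_copy_def book_graph_def by auto
  have edge: "\<kappa> (f i) (f j) = b \<and> f i \<noteq> f j" if "i < k" "j < k + n" "i \<noteq> j" for i j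
  proof -
    have "{i, j} \<in> snd (book_graph k n)"
    proof (cases "j < k")
      case True
      then show ?thesis using that by (simp add: book_graph_def Defs.complete_graph_def nsets_2_eq) blast
    next
      case False
      then have "{i, j} \<in> snd (Defs.complete_graph (insert j {..<k}))" "j \<in> {k..<k + n}"
        using that by (auto simp: Defs.complete_graph_def nsets_2_eq)
      then show ?thesis unfolding book_graph_def by auto
    qed
    then have "{f i, f j} \<in> E" using fE[of "{i, j}"] by simp
    moreover have "f i \<in> V" "f j \<in> V" using f(2) that by auto
    moreover have "f i \<noteq> f j" using f(1) that by (auto simp: inj_on_def)
    ultimately show ?thesis using E by blast
  qed
  have "f ` {k..<k + n} \<subseteq> pages \<kappa> b V (f ` {..<k})"
    using f(2) edge by (auto simp: pages_def adj_def)
  moreover have "finite (pages \<kappa> b V (f ` {..<k}))" using V by (simp add: pages_def)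
  ultimately have "card (f ` {k..<k + n}) \<le> card (pages \<kappa> b V (f ` {..<k}))"
    by (rule card_mono[rotated])
  moreover have "inj_on f {k..<k + n}" "inj_on f {..<k}"
    using f(1) by (rule inj_on_subset, force)+
  ultimately have "card (f ` {..<k}) = k" "n \<le> card (pages \<kappa> b V (f ` {..<k}))"
    by (simp_all add: card_image)
  moreover have "f ` {..<k} \<subseteq> V" using f(2) by auto
  moreover have "mono_clique \<kappa> b (f ` {..<k})"
    unfolding mono_clique_def
  proof (intro ballI impI)
    fix u v assume "u \<in> f ` {..<k}" "v \<in> f ` {..<k}" "u \<noteq> v"
    then obtain i j where "u = f i" "v = f j" "i < k" "j < k" "i \<noteq> j" by blast
    then show "\<kappa> u v = b" using edge[of i j] by simp
  qed
  ultimately show "\<exists>K\<subseteq>V. card K = k \<and> mono_clique \<kappa> b K \<and> n \<le> card (pages \<kappa> b V K)"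
    by blast
next
  assume "\<exists>K\<subseteq>V. card K = k \<and> mono_clique \<kappa> b K \<and> n \<le> card (pages \<kappa> b V K)"
  then obtain K where K: "K \<subseteq> V" "card K = k" "mono_clique \<kappa> b K" "n \<le> card (pages \<kappa> b V K)"
    by blast
  obtain T where T: "T \<subseteq> pages \<kappa> b V K" "card T = n" "finite T"
    using obtain_subset_with_card_n[OF K(4)] by metis
  have finK: "finite K" using K V finite_subset by blast
  obtain g where g: "bij_betw g {..<k} K"
    using finite_same_card_bij[of "{..<k}" K] finK K by auto
  obtain h where h: "bij_betw h {k..<k + n} T"
    using finite_same_card_bij[of "{k..<k + n}" T] T by auto
  define f where "f i = (if i < k then g i else h i)" for i
  have KT: "adj \<kappa> b u v" if "u \<in> K" "v \<in> T" for u v using that T by (auto simp: pages_def)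
  have fK: "f i \<in> K" if "i < k" for i using that g by (auto simp: f_def bij_betw_def)
  have fT: "f i \<in> T" if "k \<le> i" "i < k + n" for i using that h by (auto simp: f_def bij_betw_def)
  have TV: "T \<subseteq> V" using T by (auto simp: pages_def)
  have inj: "inj_on f {..<k + n}"
  proof (rule inj_onI)
    fix i j assume ij: "i \<in> {..<k + n}" "j \<in> {..<k + n}" "f i = f j"
    have "i < k \<longleftrightarrow> j < k"
      using fK[of i] fK[of j] fT[of i] fT[of j] KT ij by (metis adj_def lessThan_iff not_le)
    then show "i = j"
      using ij g h by (cases "i < k") (auto simp: f_def bij_betw_def inj_on_def)
  qed
  have edge: "{f i, f j} \<in> E" if "i < k" "j < k + n" "i \<noteq> j" for i j
  proof -
    have "f i \<noteq> f j" using inj that by (auto simp: inj_on_def)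
    moreover have "\<kappa> (f i) (f j) = b"
    proof (cases "j < k")
      case True
      then show ?thesis using K(3) fK that \<open>f i \<noteq> f j\<close> by (auto simp: mono_clique_def)
    next
      case False
      then show ?thesis using KT[of "f i" "f j"] fK fT that by (auto simp: adj_def)
    qed
    moreover have "f i \<in> V" "f j \<in> V" using fK fT K TV that by (metis subsetD not_le)+
    ultimately show ?thesis using E by blast
  qed
  have "f ` e \<in> E" if e: "e \<in> snd (book_graph k n)" for e
  proof -
    consider "e \<in> [{..<k}]\<^bsup>2\<^esup>" | v where "v \<in> {k..<k + n}" "e \<in> [insert v {..<k}]\<^bsup>2\<^esup>"
      using e unfolding book_graph_def Defs.complete_graph_def snd_conv Un_iff UN_iff by blast
    then obtain i j where "e = {i, j}" "i \<noteq> j" "i < k" "j < k + n"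
    proof cases
      case 1
      then show ?thesis by (elim nsets2_E) (auto intro: that)
    next
      case (2 v)
      from 2(2) obtain x y where xy: "e = {x, y}" "x \<in> insert v {..<k}" "y \<in> insert v {..<k}" "x \<noteq> y"
        by (rule nsets2_E)
      show ?thesis
      proof (cases "x < k")
        case True
        then show ?thesis using xy 2(1) by (intro that[of x y]) auto
      next
        case False
        then show ?thesis using xy 2(1) by (intro that[of y x]) auto
      qed
    qed
    then show ?thesis using edge by simp
  qed
  moreover have "f ` {..<k + n} \<subseteq> V"
  proof (rule image_subsetI)
    fix i assume i: "i \<in> {..<k + n}"
    show "f i \<in> V"
    proof (cases "i < k")
      case True
      then show ?thesis using fK K by blast
    next
      case False
      then show ?thesis using fT[of i] i TV by auto
    qed
  qed
  ultimately show "contains_copy (V, E) (book_graph k n)"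
    unfolding contains_copy_def using inj by (auto simp: book_graph_def)
qed

text \<open>Red edge sets are exchanged for symmetric colourings, with {u, v} \<in> R meaning
  \<kappa> u v.\<close>

lemma ramsey_arrows_books_iff:
  "ramsey_arrows N (book_graph k m) (book_graph k n) \<longleftrightarrow>
    (\<forall>\<kappa>. (\<forall>u v. \<kappa> u v = \<kappa> v u) \<longrightarrow>
      (\<exists>b. \<exists>K\<subseteq>{..<N}. card K = k \<and> mono_clique \<kappa> b K \<and>
        (if b then m else n) \<le> card (pages \<kappa> b {..<N} K)))"
  (is "_ \<longleftrightarrow> (\<forall>\<kappa>. ?sym \<kappa> \<longrightarrow> (\<exists>b. ?book \<kappa> b))")
proof -
  have iff: "contains_copy ({..<N}, R) (book_graph k m) \<or>
      contains_copy ({..<N}, snd (Defs.complete_graph {..<N}) - R) (book_graph k n) \<longleftrightarrow> (\<exists>b. ?book \<kappa> b)"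
    if "\<And>u v. u < N \<Longrightarrow> v < N \<Longrightarrow> u \<noteq> v \<Longrightarrow> {u, v} \<in> R \<longleftrightarrow> \<kappa> u v" for R \<kappa>
  proof -
    have "contains_copy ({..<N}, R) (book_graph k m) \<longleftrightarrow> ?book \<kappa> True"
      using contains_book_iff[of "{..<N}" R \<kappa> True k m] that by simp
    moreover have "contains_copy ({..<N}, snd (Defs.complete_graph {..<N}) - R) (book_graph k n) \<longleftrightarrow> ?book \<kappa> False"
    proof -
      have "{u, v} \<in> snd (Defs.complete_graph {..<N}) - R \<longleftrightarrow> \<kappa> u v = False"
        if "u \<in> {..<N}" "v \<in> {..<N}" "u \<noteq> v" for u v
        using that \<open>\<And>u v. u < N \<Longrightarrow> v < N \<Longrightarrow> u \<noteq> v \<Longrightarrow> {u, v} \<in> R \<longleftrightarrow> \<kappa> u v\<close>[of u v]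
        by (auto simp: Defs.complete_graph_def nsets_2_eq)
      then show ?thesis
        using contains_book_iff[of "{..<N}" "snd (Defs.complete_graph {..<N}) - R" \<kappa> False k n] by simp
    qed
    ultimately show ?thesis by (simp only: ex_bool_eq)
  qed
  show ?thesis
  proof
    assume L: "ramsey_arrows N (book_graph k m) (book_graph k n)"
    show "\<forall>\<kappa>. ?sym \<kappa> \<longrightarrow> (\<exists>b. ?book \<kappa> b)"
    proof (intro allI impI)
      fix \<kappa> :: "nat \<Rightarrow> nat \<Rightarrow> bool" assume sym: "?sym \<kappa>"
      define R where "R = {{u, v} | u v. u < N \<and> v < N \<and> u \<noteq> v \<and> \<kappa> u v}"
      have "{u, v} \<in> R \<longleftrightarrow> \<kappa> u v" if "u < N" "v < N" "u \<noteq> v" for u v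
        using sym that by (auto simp: R_def doubleton_eq_iff)
      moreover have "R \<subseteq> snd (Defs.complete_graph {..<N})"
        by (auto simp: R_def Defs.complete_graph_def nsets_2_eq)
      ultimately show "\<exists>b. ?book \<kappa> b"
        using L iff[of R \<kappa>] unfolding ramsey_arrows_def by blast
    qed
  next
    assume R: "\<forall>\<kappa>. ?sym \<kappa> \<longrightarrow> (\<exists>b. ?book \<kappa> b)"
    show "ramsey_arrows N (book_graph k m) (book_graph k n)"
      unfolding ramsey_arrows_def
    proof (intro allI impI)
      fix R
      have "\<exists>b. ?book (\<lambda>u v. {u, v} \<in> R) b"
        by (rule R[rule_format]) (simp add: insert_commute)
      then show "contains_copy ({..<N}, R) (book_graph k m) \<or>
          contains_copy ({..<N}, snd (Defs.complete_graph {..<N}) - R) (book_graph k n)"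
        using iff[of R "\<lambda>u v. {u, v} \<in> R"] by blast
    qed
  qed
qed

text \<open>\<open>D\<close> is the claimed ratio of the Ramsey number to \<open>n\<close>: on D n
  vertices, the fraction P b ^ k amounts to c n pages in red and to n in blue. A slightly smaller
  fraction of slightly more vertices is still enough.\<close>

lemma ramsey_number_books_le:
  fixes P :: "bool \<Rightarrow> real"
  assumes k: "k \<ge> 2" and P: "\<And>b. 0 < P b" "P True + P False = 1"
    and Pk: "(real k - 1) * (P True ^ k + P False ^ k) < 1"
    and ineq: "\<And>b. book_ineq k (P b)"
    and D: "D > 0" "P True ^ k * D = c" "P False ^ k * D = 1" and e: "e > 0"
  shows "eventually (\<lambda>n. real (ramsey_number (book_graph k (nat \<lfloor>c * real n\<rfloor>)) (book_graph k n))
    \<le> (D + e) * n) at_top"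
proof -
  \<comment> \<open>Strictly below P b ^ k, yet \<alpha> b * N is at least P b ^ k * D * n as soon
    as N is at least (D + e/2) n.\<close>
  define \<alpha> where "\<alpha> b = P b ^ k * (D / (D + e / 2))" for b
  have "\<exists>N0. \<forall>V \<kappa>. finite (V :: nat set) \<longrightarrow> N0 \<le> card V \<longrightarrow> (\<forall>u v. \<kappa> u v = \<kappa> v u) \<longrightarrow>
    (\<exists>b. \<not> book_bounded \<kappa> b k V (\<alpha> b * card V))"
  proof (rule monochromatic_book_exists[OF k P Pk ineq])
    fix b
    show "0 \<le> \<alpha> b" using P(1)[of b] D e by (simp add: \<alpha>_def)
    have "P b ^ k * (D / (D + e / 2)) < P b ^ k * 1"
      using P(1)[of b] D e by (intro mult_strict_left_mono) auto
    then show "\<alpha> b < P b ^ k" by (simp add: \<alpha>_def)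
  qed
  then obtain N0 where N0: "\<And>V \<kappa>. finite (V :: nat set) \<Longrightarrow> N0 \<le> card V \<Longrightarrow> (\<forall>u v. \<kappa> u v = \<kappa> v u) \<Longrightarrow>
    (\<exists>b. \<not> book_bounded \<kappa> b k V (\<alpha> b * card V))"
    by metis
  \<comment> \<open>The second condition absorbs the rounding of \<open>N\<close>, which thus stays
    below (D + e) n.\<close>
  have "eventually (\<lambda>n::nat. real N0 \<le> e / 2 * real n) at_top" "eventually (\<lambda>n::nat. 1 \<le> e / 2 * real n) at_top"
    using e by real_asymp+
  then show ?thesis
  proof eventually_elim
    case (elim n)
    define N where "N = nat \<lceil>(D + e / 2) * n\<rceil>"
    have "0 \<le> D * n" using D by simp
    moreover have "(D + e / 2) * n = D * n + e / 2 * n" "(D + e) * n = D * n + e / 2 * n + e / 2 * n"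
      by (simp_all add: field_simps)
    ultimately have X: "0 \<le> (D + e / 2) * n" "N0 \<le> (D + e / 2) * n" "(D + e / 2) * n + 1 \<le> (D + e) * n"
      using elim e by auto
    then have "real N = of_int \<lceil>(D + e / 2) * n\<rceil>"
      unfolding N_def by (intro of_nat_nat) simp
    then have "(D + e / 2) * n \<le> N" "N \<le> (D + e / 2) * n + 1"
      by (simp_all add: of_int_ceiling_le_add_one)
    then have N: "(D + e / 2) * n \<le> N" "N \<le> (D + e) * n" "N0 \<le> N"
      using X by linarith+
    have Dn: "D * n \<le> D / (D + e / 2) * N"
    proof -
      have "D / (D + e / 2) * ((D + e / 2) * n) \<le> D / (D + e / 2) * N"
        using D e N by (intro mult_left_mono) auto
      moreover have "D + e / 2 \<noteq> 0" using D e by linarith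
      ultimately show ?thesis by simp
    qed
    have "ramsey_arrows N (book_graph k (nat \<lfloor>c * real n\<rfloor>)) (book_graph k n)"
      unfolding ramsey_arrows_books_iff
    proof (intro allI impI)
      fix \<kappa> :: "nat \<Rightarrow> nat \<Rightarrow> bool" assume "\<forall>u v. \<kappa> u v = \<kappa> v u"
      then obtain b where "\<not> book_bounded \<kappa> b k {..<N} (\<alpha> b * N)"
        using N0[of "{..<N}" \<kappa>] N by fastforce
      then obtain K where K: "K \<subseteq> {..<N}" "card K = k" "mono_clique \<kappa> b K"
        "\<alpha> b * N < card (pages \<kappa> b {..<N} K)"
        by (auto simp: book_bounded_def not_le)
      have "P b ^ k * (D * n) \<le> P b ^ k * (D / (D + e / 2) * N)"
        using Dn P(1)[of b] by (intro mult_left_mono) auto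
      then have "P b ^ k * D * n < card (pages \<kappa> b {..<N} K)"
        using K(4) by (simp add: \<alpha>_def mult.assoc)
      then have "(if b then nat \<lfloor>c * real n\<rfloor> else n) \<le> card (pages \<kappa> b {..<N} K)"
        using D by (cases b) (simp_all, linarith)
      then show "\<exists>b. \<exists>K\<subseteq>{..<N}. card K = k \<and> mono_clique \<kappa> b K \<and>
          (if b then nat \<lfloor>c * real n\<rfloor> else n) \<le> card (pages \<kappa> b {..<N} K)"
        using K by blast
    qed
    then have "ramsey_number (book_graph k (nat \<lfloor>c * real n\<rfloor>)) (book_graph k n) \<le> N"
      unfolding ramsey_number_def by (rule Least_le)
    then show ?case using N by linarith
  qed
qed

text \<open>Let \<open>N\<close> be the Ramsey number itself. The quasirandom colouring on
  \<open>N\<close> vertices must contain one of the books, which forces \<open>N\<close> above (D -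
  e) n.\<close>

lemma ramsey_number_books_ge:
  fixes p c D e :: real
  assumes p: "0 \<le> p" "p \<le> 1" and c: "0 < c" "c \<le> 1"
    and D: "D > 0" "p ^ k * D = c" "(1 - p) ^ k * D = 1" and e: "e > 0"
  shows "eventually (\<lambda>n. (D - e) * n \<le>
    real (ramsey_number (book_graph k (nat \<lfloor>c * real n\<rfloor>)) (book_graph k n))) at_top"
proof -
  \<comment> \<open>Chosen so that \<eta> * D is \<open>s\<close> below. Having only (D - e) n
    vertices costs the red books 2 s n pages and, as c \<le> 1, the blue ones at least as many;
    \<eta> gives back at most s n.\<close>
  define \<eta> where "\<eta> = c * e / (2 * D\<^sup>2)"
  have \<eta>: "\<eta> > 0" using c D e by (simp add: \<eta>_def)
  obtain N0 where N0: "\<And>N::nat. N \<ge> N0 \<Longrightarrow> \<exists>\<kappa>. (\<forall>u v. \<kappa> u v = \<kappa> v u) \<and>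
    (\<forall>b. \<forall>K\<subseteq>{..<N}. card K = k \<longrightarrow>
      card (pages \<kappa> b {..<N} K) < ((if b then p else 1 - p) ^ k + \<eta>) * N)"
    using quasirandom_coloring_exists[OF p \<eta>, of k] by blast
  define s where "s = c * e / (2 * D)"
  have s: "s > 0" using c D e by (simp add: s_def)
  \<comment> \<open>The first condition makes \<open>N\<close> large enough for the random
    colouring; the second covers the page lost to the floor in \<open>m\<close>.\<close>
  have "eventually (\<lambda>n::nat. real N0 \<le> c * real n - 1) at_top" "eventually (\<lambda>n::nat. 1 \<le> s * real n) at_top"
    using c s by real_asymp+
  then show ?thesis
  proof eventually_elim
    case (elim n)
    define m where "m = nat \<lfloor>c * real n\<rfloor>"
    define N where "N = ramsey_number (book_graph k m) (book_graph k n)"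
    have m: "c * n - 1 < m" "m \<le> c * n" using elim c unfolding m_def by linarith+
    have "c * n \<le> 1 * real n" using c by (intro mult_right_mono) auto
    then have mn: "m \<le> n" using m by linarith
    have arrows: "ramsey_arrows N (book_graph k m) (book_graph k n)"
      unfolding N_def by (intro ramsey_arrows_ramsey_number simple_graph_book_graph)
    have page: "card (pages \<kappa> b {..<N} K) \<le> N" for \<kappa> b K
      using card_mono[of "{..<N}" "pages \<kappa> b {..<N} K"] by (auto simp: pages_def)
    have book: "\<exists>b. \<exists>K\<subseteq>{..<N}. card K = k \<and> mono_clique \<kappa> b K \<and>
        (if b then m else n) \<le> card (pages \<kappa> b {..<N} K)" if "\<forall>u v. \<kappa> u v = \<kappa> v u" for \<kappa>
      by (rule arrows[unfolded ramsey_arrows_books_iff, THEN spec, THEN mp, OF that])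
    \<comment> \<open>A constant colouring must already contain a book with at least
      \<open>m\<close> pages, which gives m \<le> N.\<close>
    obtain b K where "(if b then m else n) \<le> card (pages (\<lambda>_ _. True) b {..<N} K)"
      using book[of "\<lambda>_ _. True"] by blast
    then have "m \<le> N" using page[of "\<lambda>_ _. True" b K] mn by (cases b) auto
    then have "N0 \<le> N" using m elim by linarith
    from N0[OF this] obtain \<kappa> where "(\<forall>u v. \<kappa> u v = \<kappa> v u) \<and> (\<forall>b. \<forall>K\<subseteq>{..<N}. card K = k \<longrightarrow>
        card (pages \<kappa> b {..<N} K) < ((if b then p else 1 - p) ^ k + \<eta>) * N)"
      by (rule exE)
    then have \<kappa>: "\<forall>u v. \<kappa> u v = \<kappa> v u"
      "\<And>b K. K \<subseteq> {..<N} \<Longrightarrow> card K = k \<Longrightarrow>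
        card (pages \<kappa> b {..<N} K) < ((if b then p else 1 - p) ^ k + \<eta>) * N"
      by simp_all
    obtain b K where K: "K \<subseteq> {..<N}" "card K = k"
      "(if b then m else n) \<le> card (pages \<kappa> b {..<N} K)"
      using book[OF \<kappa>(1)] by blast
    have less: "(if b then m else n) < ((if b then p else 1 - p) ^ k + \<eta>) * N"
      using K(3) \<kappa>(2)[OF K(1,2), of b] by (smt (verit) of_nat_mono)
    show ?case
    proof (rule ccontr)
      assume "\<not> ?case"
      then have N: "N \<le> (D - e) * n" by (simp add: N_def m_def)
      have *: "(x + \<eta>) * N \<le> x * D * n - x * e * n + s * n" if "x \<ge> 0" for x
      proof -
        have "(x + \<eta>) * N \<le> (x + \<eta>) * ((D - e) * n)"
          using N that \<eta> by (intro mult_left_mono) auto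
        also have "\<dots> = x * D * n - x * e * n + \<eta> * D * n - \<eta> * e * n" by (simp add: algebra_simps)
        also have "\<eta> * D = s" using D by (simp add: \<eta>_def s_def power2_eq_square)
        also have "x * D * n - x * e * n + s * n - \<eta> * e * n \<le> x * D * n - x * e * n + s * n"
          using \<eta> e by simp
        finally show ?thesis .
      qed
      have x: "p ^ k = c / D" "(1 - p) ^ k = 1 / D" using D by (simp_all add: field_simps)
      show False
      proof (cases b)
        case True
        have "m < c * n - 2 * s * n + s * n"
          using less *[of "p ^ k"] True D c by (simp add: x s_def)
        then show False using m elim by (simp add: algebra_simps)
      next
        case False
        have "s \<le> e / D / 2" using c D e by (simp add: s_def field_simps)
        then have "s * n \<le> e / D / 2 * n" by (intro mult_right_mono) auto
        moreover have "n < real n - e / D * n + s * n"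
          using less *[of "(1 - p) ^ k"] False D p by (simp add: x)
        moreover have "0 \<le> e / D * n" using e D by simp
        ultimately show False by simp
      qed
    qed
  qed
qed

lemma ramsey_number_books_asymptotics:
  fixes c t :: real
  assumes k: "k \<ge> 2" and t: "0 < t" "t ^ k = c" "c \<le> 1"
    and Pk: "(real k - 1) * ((t / (1 + t)) ^ k + (1 / (1 + t)) ^ k) < 1"
    and ineq: "book_ineq k (t / (1 + t))" "book_ineq k (1 / (1 + t))"
  shows "(\<lambda>n. real (ramsey_number (book_graph k (nat \<lfloor>c * real n\<rfloor>)) (book_graph k n))
    - (t + 1) ^ k * real n) \<in> o(\<lambda>n. real n)"
proof (rule landau_o.smallI)
  fix e :: real assume e: "e > 0"
  define P where "P b = (if b then t / (1 + t) else 1 / (1 + t))" for b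
  have q: "1 - t / (1 + t) = 1 / (1 + t)" using t by (simp add: field_simps)
  have D: "(t / (1 + t)) ^ k * (t + 1) ^ k = c" "(1 / (1 + t)) ^ k * (t + 1) ^ k = 1"
    using t by (simp_all add: add.commute flip: power_mult_distrib)
  have "c > 0" using t by auto
  have up: "eventually (\<lambda>n. real (ramsey_number (book_graph k (nat \<lfloor>c * real n\<rfloor>)) (book_graph k n))
      \<le> ((t + 1) ^ k + e) * n) at_top"
    by (rule ramsey_number_books_le[of k P])
      (use k t Pk ineq D e in \<open>auto simp: P_def simp flip: add_divide_distrib\<close>)
  have "eventually (\<lambda>n. ((t + 1) ^ k - e) * n \<le>
      real (ramsey_number (book_graph k (nat \<lfloor>c * real n\<rfloor>)) (book_graph k n))) at_top"
    by (rule ramsey_number_books_ge[of "t / (1 + t)"]) (use t \<open>c > 0\<close> D e in \<open>auto simp: q\<close>)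
  with up show "eventually (\<lambda>n. norm (real (ramsey_number (book_graph k (nat \<lfloor>c * real n\<rfloor>)) (book_graph k n))
      - (t + 1) ^ k * real n) \<le> e * norm (real n)) at_top"
    by eventually_elim (simp add: algebra_simps abs_le_iff)
qed

section \<open>Choice of the threshold\<close>

text \<open>
  For \<open>k \<ge> 6\<close>, this is the solution of \<open>k q\<^sup>k\<^sup>-\<^sup>1 = 1/4\<close> with \<open>q = 1 / (1 + t)\<close>, which
  implies all conditions on \<open>t\<close>. For smaller \<open>k\<close> it would exceed \<open>1\<close>.
\<close>

definition threshold :: "nat \<Rightarrow> real" where
  "threshold k = (if k < 6 then 1 else (4 * real k) powr (1 / (real k - 1)) - 1)"

lemma threshold_bounds:
  assumes "k \<ge> 2"
  shows "0 < threshold k" "threshold k \<le> 1"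
proof -
  \<comment> \<open>This holds from 6 on (24 \<le> 32, but 20 > 16 for k = 5), hence the case
    distinction in \<open>threshold\<close>.\<close>
  have "4 * k \<le> 2 ^ (k - 1)" if "6 \<le> k" for k :: nat
    using that
  proof (induction k rule: dec_induct)
    case (step n)
    then obtain m where "n = Suc m" by (cases n) auto
    then show ?case using step by simp
  qed simp
  then have le: "4 * real k \<le> 2 ^ (k - 1)" if "6 \<le> k"
    using that by (metis of_nat_le_iff of_nat_mult of_nat_numeral of_nat_power)
  have "(4 * real k) powr (1 / (real k - 1)) \<le> (2 ^ (k - 1)) powr (1 / (real k - 1))" if "6 \<le> k"
    using le that by (intro powr_mono2) auto
  also have "(2 ^ (k - 1)) powr (1 / (real k - 1)) = (2 :: real)" if "6 \<le> k"
    using that by (simp add: powr_powr of_nat_diff flip: powr_realpow)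
  finally show "threshold k \<le> 1" by (auto simp: threshold_def)
  have "1 < (4 * real k) powr (1 / (real k - 1))" if "6 \<le> k"
    using that by (intro gr_one_powr) auto
  then show "0 < threshold k" by (auto simp: threshold_def)
qed

text \<open>For k < 6 only t = 1 is allowed, which means p = q = 1/2. For larger \<open>k\<close>,
  the threshold gives k q^(k-1) \<le> 1/4, and t \<le> 1 gives p \<le> q, hence the same for
  \<open>p\<close>. Both conditions follow from these bounds.\<close>

lemma threshold_conditions:
  assumes k: "k \<ge> 2" and t: "threshold k \<le> t" "t \<le> 1"
  shows "(real k - 1) * ((t / (1 + t)) ^ k + (1 / (1 + t)) ^ k) < 1"
    and "book_ineq k (t / (1 + t))" and "book_ineq k (1 / (1 + t))"
proof -
  define p q where "p = t / (1 + t)" and "q = 1 / (1 + t)"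
  have t0: "t > 0" using threshold_bounds[OF k] t by linarith
  have pq: "0 < p" "p \<le> q" "q < 1" "p + q = 1"
    using t0 t by (auto simp: p_def q_def divide_right_mono simp flip: add_divide_distrib)
  have "(real k - 1) * (p ^ k + q ^ k) < 1 \<and> book_ineq k p \<and> book_ineq k q"
  proof (cases "k < 6")
    case True
    then have "t = 1" using t by (simp add: threshold_def)
    then have half: "p = 1 / 2" "q = 1 / 2" by (simp_all add: p_def q_def)
    consider "k = 2" | "k = 3" | "k = 4" | "k = 5" using k True by linarith
    then show ?thesis
    proof cases
      case 4
      have "book_ineq 5 (1 / 2)" by (rule book_ineqI) (simp_all add: power_divide)
      then show ?thesis unfolding 4 half by (simp add: power_divide)
    qed (simp_all only: half, simp_all add: book_ineq_half_2 book_ineq_half_3 book_ineq_half_4 power_divide)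
  next
    case False
    have "4 * real k = ((4 * real k) powr (1 / (real k - 1))) ^ (k - 1)"
      using False by (simp add: powr_powr of_nat_diff flip: powr_realpow)
    also have "\<dots> \<le> (1 + t) ^ (k - 1)"
      using t False by (intro power_mono) (auto simp: threshold_def)
    finally have "real k * q ^ (k - 1) \<le> 1 / 4"
      using t0 by (simp add: q_def power_divide field_simps)
    moreover have "real k * p ^ (k - 1) \<le> real k * q ^ (k - 1)"
      using pq by (intro mult_left_mono power_mono) auto
    ultimately have small: "real k * p ^ (k - 1) \<le> 1 / 4" "real k * q ^ (k - 1) \<le> 1 / 4"
      by linarith+
    have "1 / 4 \<le> (1 - 1 / real k) ^ k"
      using False by (intro one_minus_inverse_power_ge) simp
    then have "book_ineq k p" "book_ineq k q"
      using small pq k by (auto intro!: book_ineqI)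
    moreover have "(real k - 1) * (p ^ k + q ^ k) < 1"
    proof -
      obtain l where l: "k = Suc l" using k by (cases k) auto
      have "(real k - 1) * (p ^ k + q ^ k) \<le> real k * (p ^ k + q ^ k)"
        using pq by (intro mult_right_mono) auto
      also have "\<dots> = p * (real k * p ^ (k - 1)) + q * (real k * q ^ (k - 1))"
        unfolding l by (simp add: algebra_simps)
      also have "\<dots> \<le> p * (1 / 4) + q * (1 / 4)"
        using small pq by (intro add_mono mult_left_mono) auto
      also have "\<dots> < 1" using pq by linarith
      finally show ?thesis .
    qed
    ultimately show ?thesis by blast
  qed
  then show "(real k - 1) * ((t / (1 + t)) ^ k + (1 / (1 + t)) ^ k) < 1"
    "book_ineq k (t / (1 + t))" "book_ineq k (1 / (1 + t))"
    by (auto simp: p_def q_def)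
qed

text \<open>The power is exp (ln (4k) / (k - 1)), whose difference from 1 is asymptotic to ln k /
  k.\<close>

lemma threshold_asymptotics: "(\<lambda>k. threshold k * real k / ln (real k) - 1) \<longlonglongrightarrow> 0"
proof -
  have "(\<lambda>k::nat. ((4 * real k) powr (1 / (real k - 1)) - 1) * real k / ln (real k) - 1) \<longlonglongrightarrow> 0"
    by real_asymp
  then show ?thesis
    by (rule Lim_transform_eventually)
      (auto simp: threshold_def eventually_at_top_linorder intro!: exI[of _ 6])
qed

theorem theorem1p3:
  shows "\<exists>c1 :: nat \<Rightarrow> real.
    (\<forall>k\<ge>2. 0 < c1 k \<and> c1 k \<le> 1 \<and>
       (\<forall>c::real. c1 k \<le> c \<and> c \<le> 1 \<longrightarrow>
          (\<lambda>n::nat. real (ramsey_number (book_graph k (nat \<lfloor>c * real n\<rfloor>)) (book_graph k n))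
                    - (c powr (1 / real k) + 1) ^ k * real n)
            \<in> o(\<lambda>n. real n))) \<and>
    (\<exists>\<epsilon> :: nat \<Rightarrow> real. \<epsilon> \<longlonglongrightarrow> 0 \<and>
       (\<forall>k\<ge>2. c1 k = ((1 + \<epsilon> k) * (ln (real k) / real k)) ^ k))"
proof (rule exI[of _ "\<lambda>k. threshold k ^ k"], intro conjI allI impI)
  fix k :: nat assume k: "2 \<le> k"
  show "0 < threshold k ^ k" "threshold k ^ k \<le> 1"
    using threshold_bounds[OF k] by (auto intro: power_le_one)
  fix c :: real assume c: "threshold k ^ k \<le> c \<and> c \<le> 1"
  \<comment> \<open>The conditions concern the k-th root \<open>t\<close> of \<open>c\<close>, so
    the k-th power of \<open>threshold k\<close> serves as \<open>c1 k\<close>.\<close>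
  define t where "t = c powr (1 / real k)"
  have "c > 0" using c \<open>0 < threshold k ^ k\<close> by linarith
  then have tk: "t > 0" "t ^ k = c" using k by (simp_all add: t_def powr_powr flip: powr_realpow)
  have "threshold k \<le> t"
    using c tk threshold_bounds[OF k] k by (metis less_eq_real_def power_mono_iff zero_less_numeral less_le_trans pos2)
  moreover have "t \<le> 1" using c \<open>c > 0\<close> by (simp add: t_def powr_le1)
  ultimately show "(\<lambda>n::nat. real (ramsey_number (book_graph k (nat \<lfloor>c * real n\<rfloor>)) (book_graph k n))
                    - (c powr (1 / real k) + 1) ^ k * real n) \<in> o(\<lambda>n. real n)"
    unfolding t_def[symmetric]
    using tk c threshold_conditions[OF k] by (intro ramsey_number_books_asymptotics k) auto
next
  show "\<exists>\<epsilon> :: nat \<Rightarrow> real. \<epsilon> \<longlonglongrightarrow> 0 \<and>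
       (\<forall>k\<ge>2. threshold k ^ k = ((1 + \<epsilon> k) * (ln (real k) / real k)) ^ k)"
    \<comment> \<open>The witness is solved from (1 + \<epsilon> k) * (ln k / k) = threshold k,
      where ln k > 0 as k \<ge> 2.\<close>
    by (rule exI[of _ "\<lambda>k. threshold k * real k / ln (real k) - 1"])
      (use threshold_asymptotics in auto)
qed

end
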